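(* Let $b>0$ be a real number with $b\neq1$, let $v_1=(1,1,1)$, $v_b=(2,b,\frac1b)$, and let $e_b=(1-s)v_1+sv_b$ with $0<s<1$. Then both $\mathcal RA[e_b]$ and $\mathcal RA[e_b]^\Gamma$ equal the full space $\mathbb C^3\otimes\mathbb C^3$ (so that $A[e_b]$ lies in the interior of $\mathbb T$), the face $\mathbb V_1[A[e_b]]$ is a proper face of $\mathbb V_1$ whose interior is contained in the interior of $\mathbb T$, and $\mathbb V_1[A[e_b]]$ is a maximal face of $\mathbb V_1$. In particular $A[e_b]$ is a separable state lying on the boundary of $\mathbb V_1$ and in the interior of $\mathbb T$.
   Context: $M_n$ is the algebra of complex $n\times n$ matrices, with matrix units $e_{ij}$. Everything takes place in $M_3\otimes M_3$, identified with $9\times 9$ matrices using the lexicographically ordered basis $e_i\otimes e_j$ of $\mathbb C^3\otimes\mathbb C^3$. States are considered without normalization of the trace. $\mathbb V_1$ is the convex cone generated by the separable states, i.e. all finite sums of matrices $zz^*$ with $z=x\otimes y$ a product vector in $\mathbb C^3\otimes\mathbb C^3$. For $A=\sum e_{ij}\otimes x_{ij}$ the partial transpose is $A^\Gamma=\sum e_{ij}\otimes x_{ji}$. $\mathbb T$ is the convex cone of all positive semi-definite $A$ with $A^\Gamma$ positive semi-definite; $\mathbb V_1\subset\mathbb T$. $\mathcal RA$ denotes the range of $A$. A convex subset $F$ of a convex set $C$ is a face of $C$ if $x,y\in C$ and $(1-t)x+ty\in F$ for some $t\in(0,1)$ imply $x,y\in F$; a maximal face is a proper face not strictly contained in another proper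 face. The interior of a convex set is its relative interior (with respect to the affine manifold it generates); points of the convex set that are not interior points are boundary points. For $A\in\mathbb V_1$, $\mathbb V_1[A]$ is the smallest face of $\mathbb V_1$ containing $A$. For nonnegative reals $a,b,c$, $A[a,b,c]$ is the $9\times9$ matrix with diagonal $(a,c,b,b,a,c,c,b,a)$, with entry $1$ at the positions $(i,j)$ for $i\ne j$ in $\{1,5,9\}$, and all other entries $0$; for $v=(a,b,c)$ we write $A[v]=A[a,b,c]$. *)

theory Defs
  imports "HOL-Analysis.Analysis"
begin

section \<open>Matrices over a tensor product\<close>

text \<open>
  \<open>\<complex>\<^sup>3 \<otimes> \<complex>\<^sup>3\<close> is modelled as functions on index pairs, the pair \<open>(i, j)\<close> standing for the basis
  vector \<open>e\<^sub>i \<otimes> e\<^sub>j\<close>. The lexicographic enumeration of the pairs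
  \<open>(1,1), (1,2), (1,3), (2,1), \<dots>, (3,3)\<close> recovers the usual \<open>9 \<times> 9\<close> matrices. In the numeral type
  \<open>3\<close> the element \<open>3\<close> is the same as \<open>0\<close>, so the three indices are \<open>1, 2, 3\<close>.
\<close>

type_synonym mat33 = "complex ^ (3 \<times> 3) ^ (3 \<times> 3)"

definition tensor_vec :: "complex ^ 'a \<Rightarrow> complex ^ 'b \<Rightarrow> complex ^ ('a::finite \<times> 'b::finite)"
  where "tensor_vec x y = (\<chi> p. x $ fst p * y $ snd p)"

definition tensor_mat ::
    "complex ^ 'a ^ 'a \<Rightarrow> complex ^ 'b ^ 'b \<Rightarrow> complex ^ ('a \<times> 'b) ^ ('a::finite \<times> 'b::finite)"
  where "tensor_mat A B = (\<chi> p q. A $ fst p $ fst q * B $ snd p $ snd q)"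

definition matrix_unit :: "'n \<Rightarrow> 'n \<Rightarrow> complex ^ 'n ^ ('n::finite)"
  where "matrix_unit i j = (\<chi> k l. if k = i \<and> l = j then 1 else 0)"

definition adjoint_mat :: "complex ^ 'n ^ 'n \<Rightarrow> complex ^ 'n ^ ('n::finite)"
  where "adjoint_mat A = (\<chi> i j. cnj (A $ j $ i))"

definition rank_one :: "complex ^ 'n \<Rightarrow> complex ^ 'n ^ ('n::finite)" \<comment> \<open>\<open>z z\<^sup>*\<close>\<close>
  where "rank_one z = (\<chi> i j. z $ i * cnj (z $ j))"

definition pos_semidef :: "complex ^ 'n ^ ('n::finite) \<Rightarrow> bool"
  where "pos_semidef A \<longleftrightarrow>
    adjoint_mat A = A \<and> (\<forall>x. 0 \<le> Re (\<Sum>i\<in>UNIV. cnj (x $ i) * (A *v x) $ i))"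

definition mat_range :: "complex ^ 'n ^ 'n \<Rightarrow> (complex ^ ('n::finite)) set"
  where "mat_range A = range (\<lambda>x. A *v x)"

definition partial_transpose ::
    "complex ^ ('a \<times> 'b) ^ ('a \<times> 'b) \<Rightarrow> complex ^ ('a \<times> 'b) ^ ('a::finite \<times> 'b::finite)"
  where "partial_transpose A = (\<chi> p q. A $ (fst q, snd p) $ (fst p, snd q))"

lemma sum_tensor_mat_unit_nth:
  "(\<Sum>i\<in>UNIV. \<Sum>j\<in>UNIV. tensor_mat (matrix_unit i j) (x i j)) $ p $ q
     = x (fst p) (fst q) $ snd p $ snd q"
proof -
  have "(\<Sum>i\<in>UNIV. \<Sum>j\<in>UNIV. tensor_mat (matrix_unit i j) (x i j)) $ p $ q
      = (\<Sum>i\<in>UNIV. \<Sum>j\<in>UNIV. if fst p = i then if fst q = j then x i j $ snd p $ snd q else 0 else 0)"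
    by (auto simp: tensor_mat_def matrix_unit_def intro!: sum.cong)
  also have "\<dots> = (\<Sum>i\<in>UNIV. if fst p = i then x i (fst q) $ snd p $ snd q else 0)"
    by (intro sum.cong) auto
  finally show ?thesis by simp
qed

lemma partial_transpose_sum_tensor:
  "partial_transpose (\<Sum>i\<in>UNIV. \<Sum>j\<in>UNIV. tensor_mat (matrix_unit i j) (x i j))
     = (\<Sum>i\<in>UNIV. \<Sum>j\<in>UNIV. tensor_mat (matrix_unit i j) (x j i))"
  unfolding vec_eq_iff partial_transpose_def sum_tensor_mat_unit_nth
  by (simp add: sum_tensor_mat_unit_nth[where x = "\<lambda>i j. x j i"] sum_tensor_mat_unit_nth)

section \<open>The cones \<open>\<bbbV>\<^sub>1\<close> and \<open>\<bbbT>\<close>\<close>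

definition V1 :: "mat33 set"
  where "V1 = {\<Sum>k<n. rank_one (tensor_vec (x k) (y k)) |
                 (n :: nat) (x :: nat \<Rightarrow> complex ^ 3) (y :: nat \<Rightarrow> complex ^ 3). True}"

definition PPT :: "mat33 set"
  where "PPT = {A. pos_semidef A \<and> pos_semidef (partial_transpose A)}"

lemma V1_eq_convex_cone_hull:
  "V1 = convex_cone hull (range (\<lambda>(x, y). rank_one (tensor_vec x y)))"
    (is "_ = _ hull ?S")
proof
  show "V1 \<subseteq> convex_cone hull ?S"
  proof
    fix A assume "A \<in> V1"
    then obtain n :: nat and x y where A: "A = (\<Sum>k<n. rank_one (tensor_vec (x k) (y k)))"
      unfolding V1_def by auto
    have "(\<Sum>k<n. rank_one (tensor_vec (x k) (y k))) \<in> convex_cone hull ?S"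
    proof (induction n)
      case 0
      show ?case by (simp add: convex_cone_hull_contains_0)
    next
      case (Suc n)
      have "rank_one (tensor_vec (x n) (y n)) \<in> convex_cone hull ?S"
        by (rule hull_inc) auto
      with Suc show ?case by (simp add: convex_cone_hull_add)
    qed
    then show "A \<in> convex_cone hull ?S" by (simp add: A)
  qed
next
  have zero: "0 \<in> V1"
    unfolding V1_def by (rule CollectI, rule exI[of _ 0]) auto
  have add: "A + B \<in> V1" if "A \<in> V1" "B \<in> V1" for A B
  proof -
    from that(1) obtain n :: nat and x y
      where A: "A = (\<Sum>k<n. rank_one (tensor_vec (x k) (y k)))" unfolding V1_def by auto
    from that(2) obtain m :: nat and x' y'
      where B: "B = (\<Sum>k<m. rank_one (tensor_vec (x' k) (y' k)))" unfolding V1_def by auto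
    let ?X = "\<lambda>k. if k < n then x k else x' (k - n)"
    let ?Y = "\<lambda>k. if k < n then y k else y' (k - n)"
    have "(\<Sum>k<n + j. rank_one (tensor_vec (?X k) (?Y k)))
        = A + (\<Sum>k<j. rank_one (tensor_vec (x' k) (y' k)))" for j
      by (induction j) (simp_all add: A add.assoc)
    from this[of m] show ?thesis
      unfolding V1_def B by (intro CollectI exI[of _ "n + m"] exI[of _ ?X] exI[of _ ?Y]) simp
  qed
  have scale: "c *\<^sub>R A \<in> V1" if "A \<in> V1" "c \<ge> 0" for A c
  proof -
    from that(1) obtain n :: nat and x y
      where A: "A = (\<Sum>k<n. rank_one (tensor_vec (x k) (y k)))" unfolding V1_def by auto
    have *: "c *\<^sub>R rank_one (tensor_vec u v) = rank_one (tensor_vec (sqrt c *\<^sub>R u) v)"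
      for u v :: "complex ^ 3"
      using that(2) by (simp add: vec_eq_iff rank_one_def tensor_vec_def)
    have "c *\<^sub>R A = (\<Sum>k<n. rank_one (tensor_vec (sqrt c *\<^sub>R x k) (y k)))"
      by (simp add: A scaleR_sum_right *)
    then show ?thesis
      unfolding V1_def
      by (intro CollectI exI[of _ n] exI[of _ "\<lambda>k. sqrt c *\<^sub>R x k"] exI[of _ y]) simp
  qed
  have "convex_cone V1"
    unfolding convex_cone_def convex_def conic_def using zero add scale by auto
  moreover have "?S \<subseteq> V1"
  proof clarify
    fix x y :: "complex ^ 3"
    show "rank_one (tensor_vec x y) \<in> V1"
      unfolding V1_def
      by (intro CollectI exI[of _ 1] exI[of _ "\<lambda>_. x"] exI[of _ "\<lambda>_. y"]) simp
  qed
  ultimately show "convex_cone hull ?S \<subseteq> V1" by (simp add: hull_minimal)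
qed

section \<open>Faces\<close>

definition smallest_face :: "'a::real_vector set \<Rightarrow> 'a \<Rightarrow> 'a set"
  where "smallest_face C x = (\<lambda>F. F face_of C) hull {x}"

definition proper_face_of :: "'a::real_vector set \<Rightarrow> 'a set \<Rightarrow> bool"  (infixr \<open>(proper'_face'_of)\<close> 50)
  where "F proper_face_of C \<longleftrightarrow> F face_of C \<and> F \<noteq> C"

definition maximal_face_of :: "'a::real_vector set \<Rightarrow> 'a set \<Rightarrow> bool"  (infixr \<open>(maximal'_face'_of)\<close> 50)
  where "F maximal_face_of C \<longleftrightarrow>
    F proper_face_of C \<and> \<not> (\<exists>G. G proper_face_of C \<and> F \<subset> G)"

definition boundary_of_convex :: "'a::euclidean_space set \<Rightarrow> 'a set"
  where "boundary_of_convex C = C - rel_interior C"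

section \<open>The matrices \<open>A[a, b, c]\<close>\<close>

text \<open>
  The case distinction encodes the diagonal \<open>(a, c, b, b, a, c, c, b, a)\<close>; the off-diagonal ones
  connect the positions \<open>1, 5, 9\<close>, which are the pairs \<open>(1,1), (2,2), (3,3)\<close>.
\<close>

definition A_mat :: "real \<times> real \<times> real \<Rightarrow> mat33"
  where "A_mat = (\<lambda>(a, b, c). \<chi> p q.
    if p = q then
      complex_of_real
        (if p \<in> {(1,1), (2,2), (3,3)} then a
         else if p \<in> {(1,3), (2,1), (3,2)} then b
         else c)
    else if p \<in> {(1,1), (2,2), (3,3)} \<and> q \<in> {(1,1), (2,2), (3,3)} then 1
    else 0)"

end

(*
The dual description: for D = b^2 - b + 1 the generalized Choi form
  q(x, y) = z* W z,  z = x (x) y,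
with diagonal entries (b-1)^2, 1, b^2 and off-diagonal entries -D, is nonnegative on product vectors,
and its zeros are, up to scalars, x (x) conj x with |x_i| = 1 and
(1, sqrt b u, 0) (x) (sqrt b, conj u, 0) with |u| = 1, together with the cyclic shifts of the latter.
Averaging the rank-one projections over the phases gives A[1,1,1] and A[2,b,1/b], so every face of
V_1 containing A[e_b] contains all of them. Conversely a functional that is nonnegative on V_1 and
vanishes at these zeros is a multiple of W on V_1: the first-order conditions at the zeros form a linear
system for its entries with a one-dimensional solution space. Hence every proper face containing
A[e_b] lies in the zero set of W, which is V_1[A[e_b]].
*)
theory Submission
  imports Defs
begin

section \<open>Sesquilinear forms and the interior of \<open>\<bbbT>\<close>\<close>

text \<open>For fixed \<open>x\<close> the form \<open>q\<close> is a diagonal form in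
  \<open>y\<close> minus a rank-one term, so its nonnegativity in \<open>y\<close> is governed by
  one cubic in the \<open>|x_i|^2\<close>, and this cubic carries a factor \<open>(b - 1)^2\<close>.
  The assumption that \<open>b\<close> differs from 1 enters in three ways: the cubic is then not
  identically zero, so its zeros can be listed; the linear system for the entries of a functional is
  solved by cancelling \<open>b - 1\<close> and \<open>b^2 - 1\<close>; and
  \<open>b + 1/b > 2\<close> makes the product of the last two coordinates of \<open>e_b\<close>
  exceed 1, which gives positive definiteness of the partial transpose. A proper face
  \<open>G\<close> containing \<open>A[e_b]\<close> is not known to be exposed, so no single
  functional is attached to it. Instead, for each product state \<open>Z\<close> in
  \<open>G\<close>, the point \<open>A[e_b] + Z\<close> lies on the relative boundary of
  \<open>V1\<close>, and a functional supporting \<open>V1\<close> there vanishes at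
  \<open>A[e_b]\<close> and at \<open>Z\<close>. By the first fact it is a multiple of
  \<open>W\<close> on \<open>V1\<close>; by the second \<open>W\<close> vanishes at
  \<open>Z\<close>.\<close>

definition sesq :: "complex ^ 'n ^ 'n \<Rightarrow> complex ^ 'n \<Rightarrow> complex ^ 'n \<Rightarrow> complex"
  where "sesq A u v = (\<Sum>p\<in>UNIV. \<Sum>q\<in>UNIV. cnj (u $ p) * A $ p $ q * v $ q)"

lemma sum_UNIV_prod:
  "(\<Sum>p\<in>UNIV. f p) = (\<Sum>i\<in>UNIV. \<Sum>j\<in>UNIV. f (i :: 'a::finite, j :: 'b::finite))"
  by (simp add: sum.cartesian_product UNIV_Times_UNIV)

lemma pos_semidef_iff_sesq:
  "pos_semidef A \<longleftrightarrow> adjoint_mat A = A \<and> (\<forall>x. 0 \<le> Re (sesq A x x))"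
  by (simp add: pos_semidef_def sesq_def matrix_vector_mult_def sum_distrib_left mult.assoc)

lemma sesq_add_left: "sesq A (u + u') v = sesq A u v + sesq A u' v"
  by (simp add: sesq_def algebra_simps sum.distrib)

lemma sesq_add_right: "sesq A u (v + v') = sesq A u v + sesq A u v'"
  by (simp add: sesq_def algebra_simps sum.distrib)

lemma sesq_scale_left: "sesq A (c *s u) v = cnj c * sesq A u v"
  by (simp add: sesq_def algebra_simps sum_distrib_left)

lemma sesq_scale_right: "sesq A u (c *s v) = c * sesq A u v"
  by (simp add: sesq_def algebra_simps sum_distrib_left)

lemma sesq_add_mat: "sesq (A + B) u v = sesq A u v + sesq B u v"
  by (simp add: sesq_def algebra_simps sum.distrib)

lemma sesq_diff_mat: "sesq (A - B) u v = sesq A u v - sesq B u v"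
  by (simp add: sesq_def algebra_simps sum_subtractf)

lemma sesq_scaleR_mat: "sesq (c *\<^sub>R A) u v = c *\<^sub>R sesq A u v"
  by (simp add: sesq_def algebra_simps scaleR_sum_right)

lemma cnj_sesq: "cnj (sesq A u v) = sesq (adjoint_mat A) v u"
  unfolding sesq_def adjoint_mat_def cnj_sum
  by (subst sum.swap) (simp add: mult_ac)

lemma sesq_rank_one:
  "sesq (rank_one z) x x = complex_of_real ((cmod (\<Sum>p\<in>UNIV. cnj (x $ p) * z $ p))\<^sup>2)"
proof -
  have "sesq (rank_one z) x x
      = (\<Sum>p\<in>UNIV. cnj (x $ p) * z $ p) * cnj (\<Sum>p\<in>UNIV. cnj (x $ p) * z $ p)"
    unfolding sesq_def rank_one_def cnj_sum sum_product by (simp add: mult_ac)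
  then show ?thesis by (simp only: complex_norm_square)
qed

lemma pos_semidef_rank_one: "pos_semidef (rank_one z)"
  by (simp add: pos_semidef_iff_sesq sesq_rank_one)
     (simp add: adjoint_mat_def rank_one_def vec_eq_iff mult.commute)

lemma adjoint_mat_add: "adjoint_mat (A + B) = adjoint_mat A + adjoint_mat B"
  by (simp add: adjoint_mat_def vec_eq_iff)

lemma adjoint_mat_scaleR: "adjoint_mat (c *\<^sub>R A) = c *\<^sub>R adjoint_mat A"
  by (simp add: adjoint_mat_def vec_eq_iff)

lemma pos_semidef_0: "pos_semidef 0"
  by (simp add: pos_semidef_def adjoint_mat_def vec_eq_iff)

lemma pos_semidef_add: "pos_semidef A \<Longrightarrow> pos_semidef B \<Longrightarrow> pos_semidef (A + B)"
  by (simp add: pos_semidef_iff_sesq adjoint_mat_add sesq_add_mat)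

lemma pos_semidef_scaleR: "pos_semidef A \<Longrightarrow> 0 \<le> c \<Longrightarrow> pos_semidef (c *\<^sub>R A)"
  by (simp add: pos_semidef_iff_sesq adjoint_mat_scaleR sesq_scaleR_mat)

lemma partial_transpose_add:
  "partial_transpose (A + B) = partial_transpose A + partial_transpose B"
  by (simp add: partial_transpose_def vec_eq_iff)

lemma partial_transpose_scaleR:
  "partial_transpose (c *\<^sub>R A) = c *\<^sub>R partial_transpose A"
  by (simp add: partial_transpose_def vec_eq_iff)

lemma partial_transpose_rank_one_tensor_vec:
  "partial_transpose (rank_one (tensor_vec x y)) = rank_one (tensor_vec (\<chi> i. cnj (x $ i)) y)"
  by (simp add: partial_transpose_def rank_one_def tensor_vec_def vec_eq_iff)

lemma adjoint_partial_transpose: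
  "adjoint_mat A = A \<Longrightarrow> adjoint_mat (partial_transpose A) = partial_transpose A"
  by (simp add: adjoint_mat_def partial_transpose_def vec_eq_iff)

lemma rank_one_tensor_in_PPT: "rank_one (tensor_vec x y) \<in> PPT"
  by (simp add: PPT_def partial_transpose_rank_one_tensor_vec pos_semidef_rank_one)

lemma convex_cone_PPT: "convex_cone PPT"
proof -
  have "partial_transpose 0 = (0 :: mat33)"
    by (simp add: partial_transpose_def vec_eq_iff)
  then show ?thesis
    by (auto simp: convex_cone_def convex_def conic_def PPT_def partial_transpose_add
        partial_transpose_scaleR pos_semidef_0 intro!: pos_semidef_add pos_semidef_scaleR
        intro: exI[of _ 0])
qed

lemma V1_subset_PPT: "V1 \<subseteq> PPT"
  unfolding V1_eq_convex_cone_hull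
  by (rule hull_minimal) (auto simp: rank_one_tensor_in_PPT convex_cone_PPT)

lemma cmod_sesq_le:
  fixes x :: "complex ^ 'n::finite"
  assumes "\<And>p q. cmod (M $ p $ q) \<le> e"
  shows "cmod (sesq M x x) \<le> real (CARD('n)) * real (CARD('n)) * e * (norm x)\<^sup>2"
proof -
  have e0: "0 \<le> e" using assms norm_ge_zero order_trans by blast
  have "cmod (sesq M x x) \<le> (\<Sum>p\<in>UNIV. \<Sum>q\<in>UNIV. cmod (cnj (x $ p) * M $ p $ q * x $ q))"
    unfolding sesq_def by (intro order_trans[OF norm_sum] sum_mono order_refl)
  also have "\<dots> \<le> (\<Sum>p\<in>(UNIV :: 'n set). \<Sum>q\<in>(UNIV :: 'n set). e * (norm x)\<^sup>2)"
  proof (intro sum_mono)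
    fix p q
    have "cmod (x $ p) * cmod (M $ p $ q) * cmod (x $ q) \<le> norm x * e * norm x"
      by (intro mult_mono) (auto simp: Finite_Cartesian_Product.norm_nth_le assms e0)
    then show "cmod (cnj (x $ p) * M $ p $ q * x $ q) \<le> e * (norm x)\<^sup>2"
      by (simp add: norm_mult power2_eq_square mult_ac)
  qed
  finally show ?thesis by (simp add: mult.assoc)
qed

lemma mat_range_UNIV_if_pos_def:
  assumes "0 < d" and "\<And>x. d * (norm x)\<^sup>2 \<le> Re (sesq A x x)"
  shows "mat_range A = UNIV"
proof -
  have "x = 0" if "A *v x = 0" for x
  proof -
    have "sesq A x x = (\<Sum>p\<in>UNIV. cnj (x $ p) * (A *v x) $ p)"
      by (simp add: sesq_def matrix_vector_mult_def sum_distrib_left mult.assoc)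
    then have "d * (norm x)\<^sup>2 \<le> 0" using assms(2)[of x] that by simp
    then show ?thesis using assms(1) by (simp add: mult_le_0_iff)
  qed
  then have "inj ((*v) A)"
    by (intro injI) (metis eq_iff_diff_eq_0 matrix_vector_mult_diff_distrib)
  then show ?thesis
    unfolding mat_range_def
    using matrix_left_invertible_injective matrix_left_right_inverse
      matrix_right_invertible_surjective by metis
qed

lemma rel_interior_PPT_if_pos_def:
  assumes "adjoint_mat A = A" and "0 < d"
    and A: "\<And>x. d * (norm x)\<^sup>2 \<le> Re (sesq A x x)"
    and AT: "\<And>x. d * (norm x)\<^sup>2 \<le> Re (sesq (partial_transpose A) x x)"
  shows "A \<in> rel_interior PPT"
proof -
  \<comment> \<open>Every point of the affine hull is Hermitian, so a nearby point can leave
    \<open>PPT\<close> only by making one of the two quadratic forms negative.\<close>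
  have herm: "affine hull PPT \<subseteq> {A. adjoint_mat A = A}"
    by (rule hull_minimal)
       (auto simp: PPT_def pos_semidef_def affine_def adjoint_mat_add adjoint_mat_scaleR)
  \<comment> \<open>\<open>81 = 9 * 9\<close> counts matrix entries: a perturbation with entries at
    most \<open>d / 81\<close> changes the form by at most \<open>d\<close> times the squared
    norm.\<close>
  have le: "0 \<le> Re (sesq B x x)"
    if "\<And>p q. cmod ((B - C) $ p $ q) \<le> d / 81" "d * (norm x)\<^sup>2 \<le> Re (sesq C x x)"
    for B C :: mat33 and x
  proof -
    have "cmod (sesq (B - C) x x) \<le> d * (norm x)\<^sup>2"
      using cmod_sesq_le[of "B - C" "d / 81" x] that(1) by simp
    moreover have "Re (sesq B x x) = Re (sesq C x x) + Re (sesq (B - C) x x)"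
      by (simp add: sesq_diff_mat)
    moreover have "- cmod (sesq (B - C) x x) \<le> Re (sesq (B - C) x x)"
      using abs_Re_le_cmod[of "sesq (B - C) x x"] by linarith
    ultimately show ?thesis using that(2) by linarith
  qed
  have "B \<in> PPT" if "B \<in> ball A (d / 81)" "B \<in> affine hull PPT" for B
  proof -
    have bd: "cmod ((B - A) $ p $ q) \<le> d / 81" for p q
      using Finite_Cartesian_Product.norm_nth_le[of "(B - A) $ p" q]
        Finite_Cartesian_Product.norm_nth_le[of "B - A" p] that(1)
      by (simp add: dist_norm norm_minus_commute)
    have "adjoint_mat B = B" using that(2) herm by auto
    moreover have "0 \<le> Re (sesq B x x)" for x
      using bd A by (rule le)
    moreover have "0 \<le> Re (sesq (partial_transpose B) x x)" for x
    proof (rule le)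
      show "cmod ((partial_transpose B - partial_transpose A) $ p $ q) \<le> d / 81" for p q
        using bd[of "(fst q, snd p)" "(fst p, snd q)"] by (simp add: partial_transpose_def)
    qed (rule AT)
    ultimately show ?thesis
      by (simp add: PPT_def pos_semidef_iff_sesq adjoint_partial_transpose)
  qed
  moreover have "0 \<le> Re (sesq A x x)" "0 \<le> Re (sesq (partial_transpose A) x x)" for x
    using A[of x] AT[of x] \<open>0 < d\<close> by (meson mult_nonneg_nonneg less_imp_le zero_le_power2 order_trans)+
  then have "A \<in> PPT"
    using assms(1) by (simp add: PPT_def pos_semidef_iff_sesq adjoint_partial_transpose)
  ultimately show ?thesis
    unfolding mem_rel_interior_ball using \<open>0 < d\<close> by (intro conjI exI[of _ "d / 81"]) auto
qed

section \<open>Positive definiteness of \<open>A[a, b, c]\<close> and of its partial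
  transpose\<close>

lemma Re_sesq_A_mat:
  "Re (sesq (A_mat (a, b, c)) x x) =
     (a - 1) * ((cmod (x $ (1,1)))\<^sup>2 + (cmod (x $ (2,2)))\<^sup>2 + (cmod (x $ (3,3)))\<^sup>2)
     + (cmod (x $ (1,1) + x $ (2,2) + x $ (3,3)))\<^sup>2
     + b * ((cmod (x $ (1,3)))\<^sup>2 + (cmod (x $ (2,1)))\<^sup>2 + (cmod (x $ (3,2)))\<^sup>2)
     + c * ((cmod (x $ (1,2)))\<^sup>2 + (cmod (x $ (2,3)))\<^sup>2 + (cmod (x $ (3,1)))\<^sup>2)"
  by (simp add: sesq_def sum_UNIV_prod sum_3 A_mat_def cmod_power2) algebra

text \<open>Partial transposition moves the entry at \<open>((i,i), (j,j))\<close> to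
  \<open>((j,i), (i,j))\<close>, so the off-diagonal ones now couple \<open>(i,j)\<close> with
  \<open>(j,i)\<close> and the form splits into a diagonal part and three binary forms.\<close>

lemma Re_sesq_partial_transpose_A_mat:
  "Re (sesq (partial_transpose (A_mat (a, b, c))) x x) =
     a * ((cmod (x $ (1,1)))\<^sup>2 + (cmod (x $ (2,2)))\<^sup>2 + (cmod (x $ (3,3)))\<^sup>2)
     + (b * (cmod (x $ (2,1)))\<^sup>2 + c * (cmod (x $ (1,2)))\<^sup>2 + 2 * Re (cnj (x $ (2,1)) * x $ (1,2)))
     + (b * (cmod (x $ (3,2)))\<^sup>2 + c * (cmod (x $ (2,3)))\<^sup>2 + 2 * Re (cnj (x $ (3,2)) * x $ (2,3)))
     + (b * (cmod (x $ (1,3)))\<^sup>2 + c * (cmod (x $ (3,1)))\<^sup>2 + 2 * Re (cnj (x $ (1,3)) * x $ (3,1)))"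
  by (simp add: sesq_def sum_UNIV_prod sum_3 A_mat_def partial_transpose_def cmod_power2) algebra

text \<open>The factor is determinant over trace of the matrix with diagonal \<open>b, c\<close> and
  off-diagonal entries 1, a lower bound for its smaller eigenvalue. Subtracting it from the diagonal
  leaves \<open>(b - d) * (c - d) = 1 + d^2\<close>, still at least 1.\<close>

lemma binary_form_ge:
  assumes "0 < b" "0 < c"
  shows "(b * c - 1) / (b + c) * ((cmod u)\<^sup>2 + (cmod v)\<^sup>2)
    \<le> b * (cmod u)\<^sup>2 + c * (cmod v)\<^sup>2 + 2 * Re (cnj u * v)"
proof -
  define d where "d = (b * c - 1) / (b + c)"
  have bd: "b - d = (b\<^sup>2 + 1) / (b + c)" and cd: "c - d = (c\<^sup>2 + 1) / (b + c)"
    using assms by (simp_all add: d_def field_simps power2_eq_square)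
  have pos: "0 < b - d" using assms unfolding bd by (intro divide_pos_pos add_nonneg_pos) auto
  have "d * (b + c) = b * c - 1"
    using assms by (simp add: d_def)
  then have "(b - d) * (c - d) = 1 + d\<^sup>2"
    by (simp add: algebra_simps power2_eq_square)
  then have ge: "1 \<le> (b - d) * (c - d)" by simp
  have "\<bar>Re (cnj u * v)\<bar> \<le> cmod u * cmod v"
    using abs_Re_le_cmod[of "cnj u * v"] by (simp add: norm_mult)
  moreover have "0 \<le> (b - d) * ((b - d) * (cmod u)\<^sup>2 + (c - d) * (cmod v)\<^sup>2 - 2 * (cmod u * cmod v))"
  proof -
    have "(b - d) * ((b - d) * (cmod u)\<^sup>2 + (c - d) * (cmod v)\<^sup>2 - 2 * (cmod u * cmod v))
        = ((b - d) * cmod u - cmod v)\<^sup>2 + ((b - d) * (c - d) - 1) * (cmod v)\<^sup>2"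
      by (simp add: algebra_simps power2_eq_square)
    then show ?thesis using ge by simp
  qed
  then have "0 \<le> (b - d) * (cmod u)\<^sup>2 + (c - d) * (cmod v)\<^sup>2 - 2 * (cmod u * cmod v)"
    using pos by (simp add: zero_le_mult_iff)
  ultimately show ?thesis unfolding d_def[symmetric] by (simp add: algebra_simps)
qed

lemma norm_sq_33:
  fixes x :: "complex ^ (3 \<times> 3)"
  shows "(norm x)\<^sup>2 = (cmod (x $ (1,1)))\<^sup>2 + (cmod (x $ (2,2)))\<^sup>2 + (cmod (x $ (3,3)))\<^sup>2
     + ((cmod (x $ (1,3)))\<^sup>2 + (cmod (x $ (2,1)))\<^sup>2 + (cmod (x $ (3,2)))\<^sup>2)
     + ((cmod (x $ (1,2)))\<^sup>2 + (cmod (x $ (2,3)))\<^sup>2 + (cmod (x $ (3,1)))\<^sup>2)"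
proof -
  have "(norm x)\<^sup>2 = (\<Sum>p\<in>UNIV. (cmod (x $ p))\<^sup>2)"
    unfolding norm_vec_def L2_set_def by (simp add: sum_nonneg)
  then show ?thesis by (simp only: sum_UNIV_prod sum_3 add_ac)
qed

lemma A_mat_pos_def:
  assumes "1 < a" "0 < b" "0 < c" "1 < b * c"
  obtains d where "0 < d"
    and "\<And>x. d * (norm x)\<^sup>2 \<le> Re (sesq (A_mat (a, b, c)) x x)"
    and "\<And>x. d * (norm x)\<^sup>2 \<le> Re (sesq (partial_transpose (A_mat (a, b, c))) x x)"
proof
  define d where "d = min (a - 1) (min b (min c ((b * c - 1) / (b + c))))"
  show "0 < d" using assms by (simp add: d_def)
  have d: "d \<le> a - 1" "d \<le> b" "d \<le> c" "d \<le> (b * c - 1) / (b + c)" by (auto simp: d_def)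
  fix x :: "complex ^ (3 \<times> 3)"
  have m: "d * (X + Y + Z) \<le> e * (X + Y + Z)" if "d \<le> e" "0 \<le> X" "0 \<le> Y" "0 \<le> Z" for X Y Z e :: real
    using that by (intro mult_right_mono) auto
  show "d * (norm x)\<^sup>2 \<le> Re (sesq (A_mat (a, b, c)) x x)"
    unfolding norm_sq_33 Re_sesq_A_mat distrib_left[of d "_ + _ + _" "_ + _ + _"]
      distrib_left[of d "_ + _ + _ + (_ + _ + _)" "_ + _ + _"]
    by (intro add_mono m d order_trans[OF m[OF d(1)]]) auto
  have n: "d * ((cmod u)\<^sup>2 + (cmod v)\<^sup>2) \<le> b * (cmod u)\<^sup>2 + c * (cmod v)\<^sup>2 + 2 * Re (cnj u * v)" for u v
    by (rule order_trans[OF mult_right_mono[OF d(4)] binary_form_ge[OF assms(2,3)]]) simp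
  define X where "X = (cmod (x $ (1,1)))\<^sup>2 + (cmod (x $ (2,2)))\<^sup>2 + (cmod (x $ (3,3)))\<^sup>2"
  have "d * X \<le> a * X" using d(1) by (intro mult_right_mono) (auto simp: X_def)
  moreover have "d * (norm x)\<^sup>2 = d * X
      + d * ((cmod (x $ (2,1)))\<^sup>2 + (cmod (x $ (1,2)))\<^sup>2)
      + d * ((cmod (x $ (3,2)))\<^sup>2 + (cmod (x $ (2,3)))\<^sup>2)
      + d * ((cmod (x $ (1,3)))\<^sup>2 + (cmod (x $ (3,1)))\<^sup>2)"
    unfolding norm_sq_33 X_def by (simp only: distrib_left add_ac)
  ultimately show "d * (norm x)\<^sup>2 \<le> Re (sesq (partial_transpose (A_mat (a, b, c))) x x)"
    unfolding Re_sesq_partial_transpose_A_mat X_def[symmetric]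
    by (simp only: add_mono[OF add_mono[OF add_mono[OF _ n] n] n])
qed

lemma adjoint_A_mat: "adjoint_mat (A_mat v) = A_mat v"
proof (cases v)
  case (fields a b c)
  have "cnj (A_mat (a, b, c) $ q $ p) = A_mat (a, b, c) $ p $ q" for p q
  proof (cases "p = q")
    case True
    then show ?thesis by (simp add: A_mat_def del: insert_iff)
  next
    case False
    then show ?thesis by (simp add: A_mat_def conj_commute del: insert_iff)
  qed
  then show ?thesis by (simp add: fields adjoint_mat_def vec_eq_iff)
qed

section \<open>The generalized Choi inequality and its equality cases\<close>

text \<open>Coefficient of \<open>|y_1|^2\<close> when the full term
  \<open>- (b^2 - b + 1) * |x1 y1 + x2 y2 + x3 y3|^2\<close> is split off; this split adds
  \<open>b^2 - b + 1\<close> to the diagonal weight \<open>(b - 1)^2\<close>. Cyclic shifts of the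
  arguments serve \<open>y_2\<close> and \<open>y_3\<close>.\<close>

definition choi_denom :: "real \<Rightarrow> real \<Rightarrow> real \<Rightarrow> real \<Rightarrow> real"
  where "choi_denom b t1 t2 t3 = ((b - 1)\<^sup>2 + (b\<^sup>2 - b + 1)) * t1 + t2 + b\<^sup>2 * t3"

definition choi_cubic :: "real \<Rightarrow> real \<Rightarrow> real \<Rightarrow> real \<Rightarrow> real"
  where "choi_cubic b t1 t2 t3 =
    choi_denom b t1 t2 t3 * choi_denom b t2 t3 t1 * choi_denom b t3 t1 t2
    - (b\<^sup>2 - b + 1) * (t1 * choi_denom b t2 t3 t1 * choi_denom b t3 t1 t2
      + t2 * choi_denom b t1 t2 t3 * choi_denom b t3 t1 t2
      + t3 * choi_denom b t1 t2 t3 * choi_denom b t2 t3 t1)"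

text \<open>
  With \<open>t\<^sub>i = |x\<^sub>i|\<^sup>2\<close>, \<open>D = b\<^sup>2 - b + 1\<close> and \<open>d\<^sub>i\<close> the denominators, the cubic is
  \<open>d\<^sub>1 d\<^sub>2 d\<^sub>3 (1 - D (t\<^sub>1/d\<^sub>1 + t\<^sub>2/d\<^sub>2 + t\<^sub>3/d\<^sub>3))\<close>. It vanishes to second order at \<open>(1, 1, 1)\<close>, so its
  expansion around \<open>(t\<^sub>3, t\<^sub>3, t\<^sub>3)\<close> has only a quadratic and a cubic term; both are visibly
  nonnegative when \<open>t\<^sub>3\<close> is the smallest of the three.
\<close>

lemma choi_cubic_eq:
  "choi_cubic b t1 t2 t3 = (b - 1)\<^sup>2 *
    ((b\<^sup>2 - b + 1)\<^sup>2 * t3 * ((t1 - t3)\<^sup>2 - (t1 - t3) * (t2 - t3) + (t2 - t3)\<^sup>2)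
     + ((t1 - t3) + b\<^sup>2 * (t2 - t3)) * (b * (t1 - t3) - (t2 - t3))\<^sup>2)"
  unfolding choi_cubic_def choi_denom_def by algebra

lemma choi_const_pos: "0 < b\<^sup>2 - b + (1::real)"
proof -
  have "b\<^sup>2 - b + 1 = (b - 1/2)\<^sup>2 + 3/4" by (simp add: power2_eq_square algebra_simps)
  then show ?thesis by (simp add: add_nonneg_pos)
qed

lemma quadratic_uv_nonneg: "0 \<le> u\<^sup>2 - u * v + (v::real)\<^sup>2"
proof -
  have "u\<^sup>2 - u * v + v\<^sup>2 = (u - v/2)\<^sup>2 + 3/4 * v\<^sup>2" by (simp add: power2_eq_square algebra_simps)
  then show ?thesis by simp
qed

lemma quadratic_uv_zero: "u\<^sup>2 - u * v + (v::real)\<^sup>2 = 0 \<Longrightarrow> u = 0 \<and> v = 0"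
proof -
  assume "u\<^sup>2 - u * v + v\<^sup>2 = 0"
  moreover have "u\<^sup>2 - u * v + v\<^sup>2 = (u - v/2)\<^sup>2 + 3/4 * v\<^sup>2"
    by (simp add: power2_eq_square algebra_simps)
  ultimately show ?thesis by (simp add: add_nonneg_eq_0_iff)
qed

lemma choi_cubic_nonneg:
  assumes "0 \<le> t3" "t3 \<le> t1" "t3 \<le> t2"
  shows "0 \<le> choi_cubic b t1 t2 t3"
proof -
  have "0 \<le> (b\<^sup>2 - b + 1)\<^sup>2 * t3 * ((t1 - t3)\<^sup>2 - (t1 - t3) * (t2 - t3) + (t2 - t3)\<^sup>2)"
    using assms(1) by (intro mult_nonneg_nonneg quadratic_uv_nonneg) auto
  moreover have "0 \<le> ((t1 - t3) + b\<^sup>2 * (t2 - t3)) * (b * (t1 - t3) - (t2 - t3))\<^sup>2"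
    using assms by (intro mult_nonneg_nonneg add_nonneg_nonneg) auto
  ultimately show ?thesis
    unfolding choi_cubic_eq by (intro mult_nonneg_nonneg[OF zero_le_power2] add_nonneg_nonneg)
qed

lemma choi_cubic_zero:
  assumes "0 \<le> t3" "t3 \<le> t1" "t3 \<le> t2" "0 < b" "b \<noteq> 1" "choi_cubic b t1 t2 t3 = 0"
  shows "t1 = t3 \<and> t2 = t3 \<or> t3 = 0 \<and> t2 = b * t1"
proof -
  let ?u = "t1 - t3" and ?v = "t2 - t3"
  have "0 \<le> (b\<^sup>2 - b + 1)\<^sup>2 * t3 * (?u\<^sup>2 - ?u * ?v + ?v\<^sup>2)"
    using assms(1) quadratic_uv_nonneg by (intro mult_nonneg_nonneg) auto
  moreover have "0 \<le> (?u + b\<^sup>2 * ?v) * (b * ?u - ?v)\<^sup>2"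
    using assms(1-3) by (intro mult_nonneg_nonneg add_nonneg_nonneg) auto
  ultimately have z: "(b\<^sup>2 - b + 1)\<^sup>2 * t3 * (?u\<^sup>2 - ?u * ?v + ?v\<^sup>2) = 0"
    "(?u + b\<^sup>2 * ?v) * (b * ?u - ?v)\<^sup>2 = 0"
    using assms(5,6) unfolding choi_cubic_eq by (auto simp: add_nonneg_eq_0_iff)
  from z(1) have 1: "t3 = 0 \<or> ?u = 0 \<and> ?v = 0"
    using choi_const_pos[of b] quadratic_uv_zero[of ?u ?v] by auto
  from z(2) have "?u + b\<^sup>2 * ?v = 0 \<or> b * ?u = ?v" by auto
  moreover have "?u = 0 \<and> ?v = 0" if "?u + b\<^sup>2 * ?v = 0"
    using that assms(2,3,4) by (subst (asm) add_nonneg_eq_0_iff) auto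
  ultimately show ?thesis using 1 by auto
qed

section \<open>The biquadratic form as a sum of squares\<close>

definition choi_form ::
    "real \<Rightarrow> complex \<Rightarrow> complex \<Rightarrow> complex \<Rightarrow> complex \<Rightarrow> complex \<Rightarrow> complex \<Rightarrow> real"
  where "choi_form b x1 x2 x3 y1 y2 y3 =
    choi_denom b ((cmod x1)\<^sup>2) ((cmod x2)\<^sup>2) ((cmod x3)\<^sup>2) * (cmod y1)\<^sup>2
    + choi_denom b ((cmod x2)\<^sup>2) ((cmod x3)\<^sup>2) ((cmod x1)\<^sup>2) * (cmod y2)\<^sup>2
    + choi_denom b ((cmod x3)\<^sup>2) ((cmod x1)\<^sup>2) ((cmod x2)\<^sup>2) * (cmod y3)\<^sup>2
    - (b\<^sup>2 - b + 1) * (cmod (x1 * y1 + x2 * y2 + x3 * y3))\<^sup>2"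

text \<open>Used to move the smallest \<open>|x_i|\<close> to the third place, where the sign of the
  cubic is visible.\<close>

lemma choi_form_cyclic: "choi_form b x1 x2 x3 y1 y2 y3 = choi_form b x2 x3 x1 y2 y3 y1"
  by (simp add: choi_form_def add_ac)

lemma complete_square:
  assumes "0 < d"
  shows "d * (cmod (y - c * cnj x / of_real d))\<^sup>2
     = d * (cmod y)\<^sup>2 - 2 * Re (cnj c * (x * y)) + (cmod c)\<^sup>2 * ((cmod x)\<^sup>2 / d)"
proof -
  have "(cmod (y - c * cnj x / of_real d))\<^sup>2
      = (Re y - Re (c * cnj x) / d)\<^sup>2 + (Im y - Im (c * cnj x) / d)\<^sup>2"
    by (simp add: cmod_power2)
  also have "d * \<dots> = d * (cmod y)\<^sup>2 - 2 * (Re y * Re (c * cnj x) + Im y * Im (c * cnj x))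
      + ((Re (c * cnj x))\<^sup>2 + (Im (c * cnj x))\<^sup>2) / d"
  proof -
    have "d * ((r - r' / d)\<^sup>2 + (i - i' / d)\<^sup>2)
        = d * (r\<^sup>2 + i\<^sup>2) - 2 * (r * r' + i * i') + (r'\<^sup>2 + i'\<^sup>2) / d" for r r' i i'
      using assms by (simp add: field_simps power2_eq_square)
    then show ?thesis unfolding cmod_power2[of y] .
  qed
  also have "(Re (c * cnj x))\<^sup>2 + (Im (c * cnj x))\<^sup>2 = (cmod c)\<^sup>2 * (cmod x)\<^sup>2"
    unfolding cmod_power2[symmetric] by (simp add: norm_mult power_mult_distrib)
  also have "Re y * Re (c * cnj x) + Im y * Im (c * cnj x) = Re (cnj c * (x * y))"
    by (simp add: algebra_simps)
  finally show ?thesis by simp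
qed

text \<open>The shifts contain \<open>m\<close>, which itself depends on \<open>y\<close>; the cross
  terms nevertheless add up to \<open>2 * D * |m|^2\<close>, because the \<open>x_i y_i\<close> sum
  to \<open>m\<close>. The leftover factor \<open>1 - D * (t1/d1 + t2/d2 + t3/d3)\<close> is the
  cubic over \<open>d1 * d2 * d3\<close>. At a zero each square vanishes, which expresses
  \<open>y\<close> through \<open>x\<close>.\<close>

lemma choi_form_eq_sum_squares:
  fixes b :: real and x1 x2 x3 y1 y2 y3 :: complex
  defines "d1 \<equiv> choi_denom b ((cmod x1)\<^sup>2) ((cmod x2)\<^sup>2) ((cmod x3)\<^sup>2)"
    and "d2 \<equiv> choi_denom b ((cmod x2)\<^sup>2) ((cmod x3)\<^sup>2) ((cmod x1)\<^sup>2)"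
    and "d3 \<equiv> choi_denom b ((cmod x3)\<^sup>2) ((cmod x1)\<^sup>2) ((cmod x2)\<^sup>2)"
    and "D \<equiv> b\<^sup>2 - b + 1" and "m \<equiv> x1 * y1 + x2 * y2 + x3 * y3"
  assumes "0 < d1" "0 < d2" "0 < d3"
  shows "choi_form b x1 x2 x3 y1 y2 y3 =
    d1 * (cmod (y1 - of_real D * m * cnj x1 / of_real d1))\<^sup>2
    + d2 * (cmod (y2 - of_real D * m * cnj x2 / of_real d2))\<^sup>2
    + d3 * (cmod (y3 - of_real D * m * cnj x3 / of_real d3))\<^sup>2
    + D * (cmod m)\<^sup>2 * (choi_cubic b ((cmod x1)\<^sup>2) ((cmod x2)\<^sup>2) ((cmod x3)\<^sup>2) / (d1 * d2 * d3))"
proof -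
  let ?c = "of_real D * m" and ?t1 = "(cmod x1)\<^sup>2" and ?t2 = "(cmod x2)\<^sup>2" and ?t3 = "(cmod x3)\<^sup>2"
  have cub: "choi_cubic b ?t1 ?t2 ?t3 = d1 * d2 * d3 - D * (?t1 * d2 * d3 + ?t2 * d1 * d3 + ?t3 * d1 * d2)"
    by (simp add: choi_cubic_def d1_def d2_def d3_def D_def)
  have quot: "choi_cubic b ?t1 ?t2 ?t3 / (d1 * d2 * d3) = 1 - D * (?t1 / d1 + ?t2 / d2 + ?t3 / d3)"
    unfolding cub using assms(6-8) by (simp add: field_simps)
  have "Re (cnj ?c * (x1 * y1)) + Re (cnj ?c * (x2 * y2)) + Re (cnj ?c * (x3 * y3)) = Re (cnj ?c * m)"
    by (simp add: m_def algebra_simps)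
  also have "cnj ?c * m = of_real (D * (cmod m)\<^sup>2)"
    using complex_norm_square[of m] by (simp add: mult_ac)
  finally have re: "Re (cnj ?c * (x1 * y1)) + Re (cnj ?c * (x2 * y2)) + Re (cnj ?c * (x3 * y3))
      = D * (cmod m)\<^sup>2" by simp
  have c: "(cmod ?c)\<^sup>2 = D\<^sup>2 * (cmod m)\<^sup>2"
    by (simp add: norm_mult power_mult_distrib)
  have "choi_form b x1 x2 x3 y1 y2 y3
      = d1 * (cmod y1)\<^sup>2 + d2 * (cmod y2)\<^sup>2 + d3 * (cmod y3)\<^sup>2 - D * (cmod m)\<^sup>2"
    by (simp add: choi_form_def d1_def d2_def d3_def D_def m_def)
  also have "\<dots> = (d1 * (cmod y1)\<^sup>2 + d2 * (cmod y2)\<^sup>2 + d3 * (cmod y3)\<^sup>2) - 2 * (D * (cmod m)\<^sup>2)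
      + D\<^sup>2 * (cmod m)\<^sup>2 * (?t1 / d1 + ?t2 / d2 + ?t3 / d3)
      + D * (cmod m)\<^sup>2 * (1 - D * (?t1 / d1 + ?t2 / d2 + ?t3 / d3))"
    by (simp add: power2_eq_square[of D] right_diff_distrib mult_ac)
  also have "\<dots> = d1 * (cmod (y1 - ?c * cnj x1 / of_real d1))\<^sup>2
    + d2 * (cmod (y2 - ?c * cnj x2 / of_real d2))\<^sup>2
    + d3 * (cmod (y3 - ?c * cnj x3 / of_real d3))\<^sup>2
    + D * (cmod m)\<^sup>2 * (1 - D * (?t1 / d1 + ?t2 / d2 + ?t3 / d3))"
    unfolding complete_square[OF assms(6)] complete_square[OF assms(7)] complete_square[OF assms(8)]
      re[symmetric] c by (simp only: distrib_left)
  finally show ?thesis unfolding quot .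
qed

lemma choi_denom_pos:
  assumes "0 < b" "0 \<le> t1" "0 \<le> t2" "0 \<le> t3" "t1 \<noteq> 0 \<or> t2 \<noteq> 0 \<or> t3 \<noteq> 0"
  shows "0 < choi_denom b t1 t2 t3"
proof -
  have k: "0 < (b - 1)\<^sup>2 + (b\<^sup>2 - b + 1)" by (rule add_nonneg_pos[OF zero_le_power2 choi_const_pos])
  have nn: "0 \<le> ((b - 1)\<^sup>2 + (b\<^sup>2 - b + 1)) * t1" "0 \<le> b\<^sup>2 * t3"
    using assms k by (auto intro!: mult_nonneg_nonneg)
  consider "0 < t1" | "0 < t2" | "0 < t3" using assms by linarith
  then show ?thesis
  proof cases
    case 1
    then show ?thesis unfolding choi_denom_def using mult_pos_pos[OF k 1] nn assms(3) by linarith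
  next
    case 2
    then show ?thesis unfolding choi_denom_def using nn by linarith
  next
    case 3
    then have "0 < b\<^sup>2 * t3" using assms(1) by simp
    then show ?thesis unfolding choi_denom_def using nn assms(3) by linarith
  qed
qed

lemma choi_form_nonneg_aux:
  assumes "0 < b" "cmod x3 \<le> cmod x1" "cmod x3 \<le> cmod x2"
  shows "0 \<le> choi_form b x1 x2 x3 y1 y2 y3"
proof (cases "x1 = 0 \<and> x2 = 0 \<and> x3 = 0")
  case True
  then show ?thesis by (simp add: choi_form_def choi_denom_def)
next
  case False
  have pos: "0 < choi_denom b ((cmod x1)\<^sup>2) ((cmod x2)\<^sup>2) ((cmod x3)\<^sup>2)"
    "0 < choi_denom b ((cmod x2)\<^sup>2) ((cmod x3)\<^sup>2) ((cmod x1)\<^sup>2)"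
    "0 < choi_denom b ((cmod x3)\<^sup>2) ((cmod x1)\<^sup>2) ((cmod x2)\<^sup>2)"
    using False assms(1) by (auto intro!: choi_denom_pos)
  have "0 \<le> choi_cubic b ((cmod x1)\<^sup>2) ((cmod x2)\<^sup>2) ((cmod x3)\<^sup>2)"
    using assms by (intro choi_cubic_nonneg) (auto intro: power_mono)
  then show ?thesis
    unfolding choi_form_eq_sum_squares[OF pos] using pos
    by (intro add_nonneg_nonneg[of "_ + _ + _"] add_nonneg_nonneg[of "_ * _"] add_nonneg_nonneg[of "_ * _ + _ * _"]
        mult_nonneg_nonneg less_imp_le[OF choi_const_pos] divide_nonneg_pos) auto
qed

lemma choi_form_nonneg:
  assumes "0 < b"
  shows "0 \<le> choi_form b x1 x2 x3 y1 y2 y3"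
proof -
  consider "cmod x3 \<le> cmod x1 \<and> cmod x3 \<le> cmod x2" | "cmod x1 \<le> cmod x2 \<and> cmod x1 \<le> cmod x3"
    | "cmod x2 \<le> cmod x3 \<and> cmod x2 \<le> cmod x1" by linarith
  then show ?thesis
    using choi_form_nonneg_aux[OF assms] choi_form_cyclic by cases metis+
qed

lemma choi_form_zero_aux:
  assumes "0 < b" "b \<noteq> 1" "cmod x3 \<le> cmod x1" "cmod x3 \<le> cmod x2"
    and "x1 \<noteq> 0 \<or> x2 \<noteq> 0 \<or> x3 \<noteq> 0" "y1 \<noteq> 0 \<or> y2 \<noteq> 0 \<or> y3 \<noteq> 0"
    and zero: "choi_form b x1 x2 x3 y1 y2 y3 = 0"
  shows "(\<exists>c k u v. cmod u = 1 \<and> cmod v = 1 \<and> x1 = c \<and> x2 = c * u \<and> x3 = c * v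
        \<and> y1 = k \<and> y2 = k * cnj u \<and> y3 = k * cnj v)
     \<or> (\<exists>c k u. cmod u = 1 \<and> x1 = c \<and> x2 = c * (of_real (sqrt b) * u) \<and> x3 = 0
        \<and> y1 = k * of_real (sqrt b) \<and> y2 = k * cnj u \<and> y3 = 0)"
proof -
  let ?t1 = "(cmod x1)\<^sup>2" and ?t2 = "(cmod x2)\<^sup>2" and ?t3 = "(cmod x3)\<^sup>2"
  define d1 where "d1 = choi_denom b ?t1 ?t2 ?t3"
  define d2 where "d2 = choi_denom b ?t2 ?t3 ?t1"
  define d3 where "d3 = choi_denom b ?t3 ?t1 ?t2"
  define D where "D = b\<^sup>2 - b + 1"
  define m where "m = x1 * y1 + x2 * y2 + x3 * y3"
  have pos: "0 < d1" "0 < d2" "0 < d3"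
    using assms(1,5) by (auto simp: d1_def d2_def d3_def intro!: choi_denom_pos)
  have D: "0 < D" using choi_const_pos by (simp add: D_def)
  have cub: "0 \<le> choi_cubic b ?t1 ?t2 ?t3"
    using assms(3,4) by (intro choi_cubic_nonneg) (auto intro: power_mono)
  have "0 = d1 * (cmod (y1 - of_real D * m * cnj x1 / of_real d1))\<^sup>2
    + d2 * (cmod (y2 - of_real D * m * cnj x2 / of_real d2))\<^sup>2
    + d3 * (cmod (y3 - of_real D * m * cnj x3 / of_real d3))\<^sup>2
    + D * (cmod m)\<^sup>2 * (choi_cubic b ?t1 ?t2 ?t3 / (d1 * d2 * d3))"
    using choi_form_eq_sum_squares[of b x1 x2 x3 y1 y2 y3] pos zero
    by (simp add: d1_def d2_def d3_def D_def m_def)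
  moreover have "0 \<le> d1 * (cmod (y1 - of_real D * m * cnj x1 / of_real d1))\<^sup>2"
    "0 \<le> d2 * (cmod (y2 - of_real D * m * cnj x2 / of_real d2))\<^sup>2"
    "0 \<le> d3 * (cmod (y3 - of_real D * m * cnj x3 / of_real d3))\<^sup>2"
    "0 \<le> D * (cmod m)\<^sup>2 * (choi_cubic b ?t1 ?t2 ?t3 / (d1 * d2 * d3))"
    using pos D cub by auto
  ultimately have "d1 * (cmod (y1 - of_real D * m * cnj x1 / of_real d1))\<^sup>2 = 0"
    "d2 * (cmod (y2 - of_real D * m * cnj x2 / of_real d2))\<^sup>2 = 0"
    "d3 * (cmod (y3 - of_real D * m * cnj x3 / of_real d3))\<^sup>2 = 0"
    "D * (cmod m)\<^sup>2 * (choi_cubic b ?t1 ?t2 ?t3 / (d1 * d2 * d3)) = 0"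
    by linarith+
  then have y: "y1 = of_real D * m * cnj x1 / of_real d1" "y2 = of_real D * m * cnj x2 / of_real d2"
      "y3 = of_real D * m * cnj x3 / of_real d3"
    and "m = 0 \<or> choi_cubic b ?t1 ?t2 ?t3 = 0"
    using pos D by auto
  \<comment> \<open>With \<open>m = 0\<close> the three formulas would give
    \<open>y = 0\<close>.\<close>
  then have "choi_cubic b ?t1 ?t2 ?t3 = 0" using assms(6) by auto
  then have "?t1 = ?t3 \<and> ?t2 = ?t3 \<or> ?t3 = 0 \<and> ?t2 = b * ?t1"
    using assms(1-4) by (intro choi_cubic_zero) (auto intro: power_mono)
  then show ?thesis
  proof
    assume t: "?t1 = ?t3 \<and> ?t2 = ?t3"
    then have n: "cmod x1 = cmod x3" "cmod x2 = cmod x3" by auto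
    then have x1: "x1 \<noteq> 0" using assms(5) by auto
    have "x3 \<noteq> 0" using n x1 by auto
    \<comment> \<open>Equal denominators make \<open>y\<close> proportional to the conjugate of
      \<open>x\<close>.\<close>
    have d: "d2 = d1" "d3 = d1" using t by (simp_all add: d1_def d2_def d3_def)
    have "cmod (x2 / x1) = 1 \<and> cmod (x3 / x1) = 1 \<and> x1 = x1 \<and> x2 = x1 * (x2 / x1)
      \<and> x3 = x1 * (x3 / x1) \<and> y1 = y1 \<and> y2 = y1 * cnj (x2 / x1) \<and> y3 = y1 * cnj (x3 / x1)"
      using n x1 \<open>x3 \<noteq> 0\<close> by (simp add: y d norm_divide)
    then show ?thesis by blast
  next
    assume t: "?t3 = 0 \<and> ?t2 = b * ?t1"
    have x3: "x3 = 0" using t by simp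
    have x1: "x1 \<noteq> 0" using t assms(5) by auto
    have d: "d1 = 2 * D * ?t1" "d2 = b * (2 * D * ?t1)"
      using t by (simp_all add: d1_def d2_def choi_denom_def D_def power2_eq_square[of b]
          power2_diff algebra_simps)
    have s: "sqrt b \<noteq> 0" "of_real (sqrt b) * of_real (sqrt b) = complex_of_real b"
      using assms(1) by (simp_all flip: of_real_mult)
    have n: "cmod x2 = sqrt b * cmod x1"
      using t by (metis abs_norm_cancel real_sqrt_abs real_sqrt_mult)
    let ?u = "x2 / (of_real (sqrt b) * x1)" and ?k = "y1 / of_real (sqrt b)"
    have "cmod ?u = 1" using n x1 s(1) assms(1) by (simp add: norm_divide norm_mult)
    moreover have "y2 = ?k * cnj ?u"
      using x1 s pos unfolding y d by (simp add: field_simps)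
    moreover have "y3 = 0" by (simp add: y x3)
    moreover have "x2 = x1 * (of_real (sqrt b) * ?u)" "y1 = ?k * of_real (sqrt b)"
      using x1 s(1) by simp_all
    ultimately show ?thesis
      using x3 by blast
  qed
qed

section \<open>Faces of \<open>\<bbbV>\<^sub>1\<close>\<close>

lemma convex_cone_V1: "convex_cone V1"
  unfolding V1_eq_convex_cone_hull by (rule convex_cone_convex_cone_hull)

lemma rank_one_tensor_in_V1: "rank_one (tensor_vec x y) \<in> V1"
  unfolding V1_eq_convex_cone_hull by (rule hull_inc) auto

lemma V1_add: "A \<in> V1 \<Longrightarrow> B \<in> V1 \<Longrightarrow> A + B \<in> V1"
  using convex_cone_V1 convex_cone_add by blast

lemma V1_scaleR: "A \<in> V1 \<Longrightarrow> 0 \<le> c \<Longrightarrow> c *\<^sub>R A \<in> V1"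
  using convex_cone_V1 convex_cone_scaleR by blast

lemma convex_cone_sum:
  assumes "convex_cone C" "\<And>k. k \<in> I \<Longrightarrow> f k \<in> C"
  shows "sum f I \<in> C"
  using assms(2)
proof (induction I rule: infinite_finite_induct)
  case (insert k I)
  then show ?case by (simp add: convex_cone_add[OF assms(1)])
qed (simp_all add: convex_cone_contains_0[OF assms(1)])

lemma V1_sum: "(\<And>k. k \<in> I \<Longrightarrow> f k \<in> V1) \<Longrightarrow> (\<Sum>k\<in>I. f k) \<in> V1"
  using convex_cone_V1 convex_cone_sum by blast

text \<open>A nonzero \<open>x\<close> lies strictly between \<open>c x\<close> and
  \<open>2 x\<close> if \<open>c < 1\<close>, and between \<open>0\<close> and \<open>c x\<close> if
  \<open>c > 1\<close>. The trivial cases are removed beforehand because an open segment with equal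
  ends is empty.\<close>

lemma face_of_cone_scaleR:
  assumes "F face_of C" "convex_cone C" "x \<in> F" "0 < c"
  shows "c *\<^sub>R x \<in> F"
proof (cases "x = 0 \<or> c = 1")
  case True
  then show ?thesis using assms(3) by auto
next
  case False
  have C: "x \<in> C" using assms(1,3) face_of_imp_subset by blast
  have cone: "k *\<^sub>R x \<in> C" if "0 \<le> k" for k
    using assms(2) C that by (simp add: convex_cone_scaleR)
  have seg: "x \<in> open_segment (a *\<^sub>R x) (d *\<^sub>R x)" if "a < 1" "1 < d" for a d
  proof -
    define t where "t = (1 - a) / (d - a)"
    have "t * (d - a) = 1 - a" using that by (simp add: t_def)
    then have "(1 - t) * a + t * d = 1" by (simp add: algebra_simps)
    then have "x = (1 - t) *\<^sub>R (a *\<^sub>R x) + t *\<^sub>R (d *\<^sub>R x)"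
      by (simp flip: scaleR_left_distrib)
    moreover have "a *\<^sub>R x \<noteq> d *\<^sub>R x" using that False by simp
    ultimately show ?thesis
      unfolding in_segment using that
      by (intro conjI exI[of _ t]) (auto simp: t_def field_simps)
  qed
  show ?thesis
  proof (cases "c < 1")
    case True
    then show ?thesis
      using face_ofD[OF assms(1) seg[of c 2]] cone assms(3,4) by simp
  next
    case c: False
    then show ?thesis
      using face_ofD[OF assms(1) seg[of 0 c]] cone[of 0] cone[of c] False assms(3,4) by simp
  qed
qed

text \<open>\<open>x + y\<close> is the midpoint of \<open>2 x\<close> and \<open>2 y\<close>; equal
  summands are treated apart since that segment degenerates.\<close>

lemma face_of_cone_addD:
  assumes "F face_of C" "convex_cone C" "x \<in> C" "y \<in> C" "x + y \<in> F"
  shows "x \<in> F" "y \<in> F"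
proof -
  have "2 *\<^sub>R x \<in> F \<and> 2 *\<^sub>R y \<in> F"
  proof (cases "x = y")
    case True
    then show ?thesis using assms(5) by (simp add: scaleR_2)
  next
    case False
    have "x + y \<in> open_segment (2 *\<^sub>R x) (2 *\<^sub>R y)"
      unfolding in_segment using False by (intro conjI exI[of _ "1/2"]) auto
    then show ?thesis
      using face_ofD[OF assms(1)] convex_cone_scaleR[OF assms(2)] assms(3-5) by simp
  qed
  then show "x \<in> F" "y \<in> F"
    using face_of_cone_scaleR[OF assms(1,2), of _ "1/2"] by fastforce+
qed

lemma face_of_cone_add:
  assumes "F face_of C" "convex_cone C" "x \<in> F" "y \<in> F"
  shows "x + y \<in> F"
proof -
  have "(1/2) *\<^sub>R (2 *\<^sub>R x) + (1/2) *\<^sub>R (2 *\<^sub>R y) \<in> F"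
    using assms face_of_imp_convex[OF assms(1)] face_of_cone_scaleR[OF assms(1,2)]
    by (intro convexD) auto
  then show ?thesis by simp
qed

lemma face_of_cone_scaleRD:
  assumes "F face_of C" "convex_cone C" "0 < c" "c *\<^sub>R x \<in> F"
  shows "x \<in> F"
  using face_of_cone_scaleR[OF assms(1,2,4), of "1 / c"] assms(3) by simp

lemma face_of_cone_sumD:
  assumes "F face_of C" "convex_cone C" "finite I" "\<And>k. k \<in> I \<Longrightarrow> f k \<in> C"
    and "(\<Sum>k\<in>I. f k) \<in> F" "k \<in> I"
  shows "f k \<in> F"
proof -
  have "(\<Sum>k\<in>I - {k}. f k) \<in> C"
    using assms(2,4) by (intro convex_cone_sum) auto
  then show ?thesis
    using face_of_cone_addD(1)[OF assms(1,2), of "f k" "\<Sum>k\<in>I - {k}. f k"] assms(3-6)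
    by (simp add: sum.remove)
qed

text \<open>
  The product vectors, up to scalars, on which the Choi form vanishes: \<open>x \<otimes> cnj x\<close> with unimodular
  entries, and one family on each of the three coordinate planes.
\<close>

definition phase_zero :: "complex \<Rightarrow> complex \<Rightarrow> complex ^ (3 \<times> 3)"
  where "phase_zero u v = tensor_vec (vector [1, u, v]) (vector [1, cnj u, cnj v])"

definition edge_zero1 :: "real \<Rightarrow> complex \<Rightarrow> complex ^ (3 \<times> 3)"
  where "edge_zero1 b u = tensor_vec (vector [1, of_real (sqrt b) * u, 0]) (vector [of_real (sqrt b), cnj u, 0])"

definition edge_zero2 :: "real \<Rightarrow> complex \<Rightarrow> complex ^ (3 \<times> 3)"
  where "edge_zero2 b u = tensor_vec (vector [0, 1, of_real (sqrt b) * u]) (vector [0, of_real (sqrt b), cnj u])"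

definition edge_zero3 :: "real \<Rightarrow> complex \<Rightarrow> complex ^ (3 \<times> 3)"
  where "edge_zero3 b u = tensor_vec (vector [of_real (sqrt b) * u, 0, 1]) (vector [cnj u, 0, of_real (sqrt b)])"

definition choi_zeros :: "real \<Rightarrow> (complex ^ (3 \<times> 3)) set"
  where "choi_zeros b = {phase_zero u v | u v. cmod u = 1 \<and> cmod v = 1}
    \<union> {z. \<exists>u. cmod u = 1 \<and> (z = edge_zero1 b u \<or> z = edge_zero2 b u \<or> z = edge_zero3 b u)}"

text \<open>
  Averaging over fourth roots of unity agrees with averaging over the whole torus, because the
  exponents of each phase in an entry of \<open>z z\<^sup>*\<close> lie between \<open>-2\<close> and \<open>2\<close>, and \<open>\<plusminus>2\<close> is not
  \<open>0\<close> modulo \<open>4\<close>.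
\<close>

lemma sum_phases_rank_one:
  assumes "cmod u = 1" "cmod v = 1"
  shows "(\<Sum>k<4. \<Sum>l<4. rank_one (phase_zero (\<i> ^ k * u) (\<i> ^ l * v))) = 16 *\<^sub>R A_mat (1, 1, 1)"
proof -
  have u: "u * cnj u = 1" and v: "v * cnj v = 1"
    using assms complex_norm_square[of u] complex_norm_square[of v] by simp_all
  have u': "u * (cnj u * z) = z" and v': "v * (cnj v * z) = z" for z
    using u v by (simp_all flip: mult.assoc)
  show ?thesis
    by (simp add: vec_eq_iff forall_3 eval_nat_numeral rank_one_def phase_zero_def tensor_vec_def
        A_mat_def u v u' v' mult_ac scaleR_conv_of_real[where 'a = complex])
qed

text \<open>An edge vector has squared moduli \<open>b, b\<close> on the two diagonal pairs,
  \<open>b^2\<close> on the pair in a \<open>b\<close>-slot and 1 on the one in a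
  \<open>c\<close>-slot. Each diagonal pair lies in two edges, whence the 2 after division by
  \<open>b\<close>; the 4 counts the phases.\<close>

lemma sum_edges_rank_one:
  assumes "cmod u = 1" "0 < b"
  shows "(\<Sum>k<4. rank_one (edge_zero1 b (\<i> ^ k * u)) + rank_one (edge_zero2 b (\<i> ^ k * u))
      + rank_one (edge_zero3 b (\<i> ^ k * u))) = (4 * b) *\<^sub>R A_mat (2, b, 1 / b)"
proof -
  have u: "u * cnj u = 1"
    using assms complex_norm_square[of u] by simp
  have u': "u * (cnj u * z) = z" for z
    using u by (simp flip: mult.assoc)
  define s where "s = complex_of_real (sqrt b)"
  have s: "s * s = of_real b" "cnj s = s"
    using assms(2) by (simp_all add: s_def flip: of_real_mult)
  have s': "s * (s * z) = of_real b * z" for z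
    using s(1) by (simp flip: mult.assoc)
  show ?thesis
    unfolding edge_zero1_def edge_zero2_def edge_zero3_def s_def[symmetric]
    using assms(2)
    by (simp add: vec_eq_iff forall_3 eval_nat_numeral rank_one_def tensor_vec_def
        A_mat_def u u' s s' mult_ac scaleR_conv_of_real[where 'a = complex])
qed

lemma A_mat_convex_comb:
  "A_mat ((1 - s) *\<^sub>R v + s *\<^sub>R w) = (1 - s) *\<^sub>R A_mat v + s *\<^sub>R A_mat w"
  by (cases v; cases w) (simp add: vec_eq_iff forall_3 A_mat_def scaleR_conv_of_real[where 'a = complex])

lemma A_mat_111_in_V1: "A_mat (1, 1, 1) \<in> V1"
proof -
  have "16 *\<^sub>R A_mat (1, 1, 1) \<in> V1"
    unfolding sum_phases_rank_one[of 1 1, symmetric, simplified] phase_zero_def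
    by (intro V1_sum rank_one_tensor_in_V1)
  then show ?thesis using V1_scaleR[of "16 *\<^sub>R A_mat (1, 1, 1)" "1/16"] by simp
qed

lemma edge_zeros_in_V1:
  "rank_one (edge_zero1 b u) \<in> V1" "rank_one (edge_zero2 b u) \<in> V1" "rank_one (edge_zero3 b u) \<in> V1"
  by (simp_all add: edge_zero1_def edge_zero2_def edge_zero3_def rank_one_tensor_in_V1)

lemma A_mat_2b_in_V1:
  assumes "0 < b"
  shows "A_mat (2, b, 1 / b) \<in> V1"
proof -
  have "(4 * b) *\<^sub>R A_mat (2, b, 1 / b) \<in> V1"
    unfolding sum_edges_rank_one[of 1 b, OF _ assms, symmetric, simplified]
    by (intro V1_sum V1_add edge_zeros_in_V1)
  then show ?thesis using V1_scaleR[of "(4 * b) *\<^sub>R A_mat (2, b, 1 / b)" "1/(4 * b)"] assms by simp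
qed

lemma choi_zeros_in_face:
  assumes F: "F face_of V1" and "0 < b" "0 < s" "s < 1"
    and mem: "A_mat ((1 - s) *\<^sub>R (1, 1, 1) + s *\<^sub>R (2, b, 1 / b)) \<in> F"
    and z: "z \<in> choi_zeros b"
  shows "rank_one z \<in> F"
proof -
  note cone = F convex_cone_V1
  have V: "A_mat (1, 1, 1) \<in> V1" "A_mat (2, b, 1 / b) \<in> V1"
    using A_mat_111_in_V1 A_mat_2b_in_V1[OF assms(2)] .
  have parts: "(1 - s) *\<^sub>R A_mat (1, 1, 1) \<in> F" "s *\<^sub>R A_mat (2, b, 1 / b) \<in> F"
    using face_of_cone_addD[OF cone _ _ mem[unfolded A_mat_convex_comb]] V V1_scaleR assms(3,4)
    by simp_all
  have A1: "A_mat (1, 1, 1) \<in> F"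
    using face_of_cone_scaleRD[OF cone _ parts(1)] assms(4) by simp
  have A2: "A_mat (2, b, 1 / b) \<in> F"
    using face_of_cone_scaleRD[OF cone _ parts(2)] assms(3) by simp
  show ?thesis
  proof (cases "\<exists>u v. cmod u = 1 \<and> cmod v = 1 \<and> z = phase_zero u v")
    case True
    then obtain u v where uv: "cmod u = 1" "cmod v = 1" and z: "z = phase_zero u v" by blast
    \<comment> \<open>The grid of phases is rotated to start at \<open>(u, v)\<close>, so the given
      vector is the term \<open>k = l = 0\<close> of the sum.\<close>
    let ?f = "\<lambda>k l. rank_one (phase_zero (\<i> ^ k * u) (\<i> ^ l * v))"
    have f: "?f k l \<in> V1" for k l by (simp add: phase_zero_def rank_one_tensor_in_V1)
    have "(\<Sum>k<4. \<Sum>l<4. ?f k l) \<in> F"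
      unfolding sum_phases_rank_one[OF uv] using A1 by (rule face_of_cone_scaleR[OF cone]) simp
    then have "(\<Sum>l<4. ?f 0 l) \<in> F"
      by (rule face_of_cone_sumD[OF cone finite_lessThan, rotated]) (auto intro: V1_sum f)
    then have "?f 0 0 \<in> F"
      by (rule face_of_cone_sumD[OF cone finite_lessThan, rotated]) (auto simp: phase_zero_def rank_one_tensor_in_V1)
    then show ?thesis by (simp add: z)
  next
    case False
    then obtain u where u: "cmod u = 1"
      and z: "z = edge_zero1 b u \<or> z = edge_zero2 b u \<or> z = edge_zero3 b u"
      using z by (auto simp: choi_zeros_def)
    let ?f = "\<lambda>k. rank_one (edge_zero1 b (\<i> ^ k * u)) + rank_one (edge_zero2 b (\<i> ^ k * u))
      + rank_one (edge_zero3 b (\<i> ^ k * u))"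
    have "(\<Sum>k<4. ?f k) \<in> F"
      unfolding sum_edges_rank_one[OF u assms(2)] using A2 by (rule face_of_cone_scaleR[OF cone]) (simp add: assms)
    then have "?f 0 \<in> F"
      by (rule face_of_cone_sumD[OF cone finite_lessThan, rotated]) (auto intro!: V1_add edge_zeros_in_V1)
    then have f0: "rank_one (edge_zero1 b u) + rank_one (edge_zero2 b u) + rank_one (edge_zero3 b u) \<in> F"
      by simp
    have "rank_one (edge_zero1 b u) + rank_one (edge_zero2 b u) \<in> F"
      and 3: "rank_one (edge_zero3 b u) \<in> F"
      using face_of_cone_addD[OF cone _ _ f0] by (auto intro: V1_add edge_zeros_in_V1)
    then have "rank_one (edge_zero1 b u) \<in> F" "rank_one (edge_zero2 b u) \<in> F"
      using face_of_cone_addD[OF cone edge_zeros_in_V1(1,2)] by auto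
    with 3 z show ?thesis by auto
  qed
qed

section \<open>Uniqueness of the supporting functional\<close>

text \<open>The exponents -1, 0, 1, 2 are distinct modulo 4, so the values at the fourth roots of
  unity determine all coefficients.\<close>

lemma trig_poly_coeffs:
  assumes "\<And>u. cmod u = 1 \<Longrightarrow> a * cnj u + b + c * u + d * (u * u) = 0"
  shows "a = 0" "b = 0" "c = 0" "d = 0"
proof -
  have 1: "a + b + c + d = 0" and 2: "- a + b - c + d = 0"
    and 3: "- (a * \<i>) + b + c * \<i> - d = 0" and 4: "a * \<i> + b - c * \<i> - d = 0"
    using assms[of 1] assms[of "-1"] assms[of \<i>] assms[of "-\<i>"] by simp_all
  have "2 * b + 2 * d = 0" using 1 2 by algebra
  moreover have "2 * b - 2 * d = 0" using 3 4 by algebra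
  ultimately show "b = 0" "d = 0" by algebra+
  then have "a + c = 0" "a * \<i> - c * \<i> = 0" using 1 4 by simp_all
  then have "a + c = 0" "a - c = 0" by (simp_all flip: left_diff_distrib)
  then show "a = 0" "c = 0" by algebra+
qed

text \<open>With \<open>w = (1, u, v)\<close>, two monomials \<open>w_j w_k cnj w_l\<close> agree on
  the torus only by exchanging \<open>j\<close> and \<open>k\<close> or by cancelling
  \<open>w_l\<close> against an equal factor. The last three conclusions are the coefficients of
  \<open>w_1\<close>, \<open>w_2\<close>, \<open>w_3\<close>.\<close>

lemma cubic_trig_poly_coeffs:
  fixes c :: "3 \<Rightarrow> 3 \<Rightarrow> 3 \<Rightarrow> complex"
  assumes zero: "\<And>u v. cmod u = 1 \<Longrightarrow> cmod v = 1 \<Longrightarrow>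
    (\<Sum>j\<in>UNIV. \<Sum>k\<in>UNIV. \<Sum>l\<in>UNIV. c j k l * (vector [1, u, v] $ j * vector [1, u, v] $ k * cnj (vector [1, u, v] $ l))) = 0"
  shows "\<And>j l. j \<noteq> l \<Longrightarrow> c j j l = 0"
    and "\<And>j k l. j \<noteq> k \<Longrightarrow> k \<noteq> l \<Longrightarrow> j \<noteq> l \<Longrightarrow> c j k l + c k j l = 0"
    and "c 1 1 1 + c 1 2 2 + c 2 1 2 + c 1 3 3 + c 3 1 3 = 0"
    and "c 2 2 2 + c 1 2 1 + c 2 1 1 + c 2 3 3 + c 3 2 3 = 0"
    and "c 3 3 3 + c 1 3 1 + c 3 1 1 + c 2 3 2 + c 3 2 2 = 0"
proof -
  \<comment> \<open>\<open>A\<close>, \<open>B\<close>, \<open>C\<close>, \<open>D\<close> collect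
    the powers -1, 0, 1, 2 of \<open>u\<close>; each is then a polynomial of the same kind in
    \<open>v\<close>.\<close>
  define A where "A v = c 1 1 2 + (c 1 3 2 + c 3 1 2) * v + c 3 3 2 * (v * v)" for v
  define B where "B v = c 1 1 3 * cnj v + (c 1 1 1 + c 1 2 2 + c 2 1 2 + c 1 3 3 + c 3 1 3)
    + (c 3 3 3 + c 1 3 1 + c 3 1 1 + c 2 3 2 + c 3 2 2) * v + c 3 3 1 * (v * v)" for v
  define C where "C v = (c 2 1 3 + c 1 2 3) * cnj v + (c 2 2 2 + c 1 2 1 + c 2 1 1 + c 2 3 3 + c 3 2 3)
    + (c 2 3 1 + c 3 2 1) * v" for v
  define D where "D v = c 2 2 3 * cnj v + c 2 2 1" for v
  have eq: "A v * cnj u + B v + C v * u + D v * (u * u) = 0" if "cmod u = 1" "cmod v = 1" for u v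
  proof -
    have u: "u * cnj u = 1" and v: "v * cnj v = 1"
      using that complex_norm_square[of u] complex_norm_square[of v] by simp_all
    have u': "u * (cnj u * z) = z" and v': "v * (cnj v * z) = z" for z
      using u v by (simp_all flip: mult.assoc)
    show ?thesis
      using zero[OF that] unfolding A_def B_def C_def D_def
      by (simp add: sum_3 algebra_simps u v u' v')
  qed
  have "A v = 0" "B v = 0" "C v = 0" "D v = 0" if "cmod v = 1" for v
    using trig_poly_coeffs[OF eq[OF _ that]] by blast+
  then have A: "0 * cnj v + c 1 1 2 + (c 1 3 2 + c 3 1 2) * v + c 3 3 2 * (v * v) = 0"
    and B: "c 1 1 3 * cnj v + (c 1 1 1 + c 1 2 2 + c 2 1 2 + c 1 3 3 + c 3 1 3)
      + (c 3 3 3 + c 1 3 1 + c 3 1 1 + c 2 3 2 + c 3 2 2) * v + c 3 3 1 * (v * v) = 0"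
    and C: "(c 2 1 3 + c 1 2 3) * cnj v + (c 2 2 2 + c 1 2 1 + c 2 1 1 + c 2 3 3 + c 3 2 3)
      + (c 2 3 1 + c 3 2 1) * v + 0 * (v * v) = 0"
    and D: "c 2 2 3 * cnj v + c 2 2 1 + 0 * v + 0 * (v * v) = 0" if "cmod v = 1" for v
    using that by (simp_all add: A_def B_def C_def D_def)
  note A = trig_poly_coeffs[OF A] and B = trig_poly_coeffs[OF B]
    and C = trig_poly_coeffs[OF C] and D = trig_poly_coeffs[OF D]
  have "\<forall>j l. j \<noteq> l \<longrightarrow> c j j l = 0"
    using A B D by (simp add: forall_3)
  then show "\<And>j l. j \<noteq> l \<Longrightarrow> c j j l = 0" by blast
  have "\<forall>j k l. j \<noteq> k \<longrightarrow> k \<noteq> l \<longrightarrow> j \<noteq> l \<longrightarrow> c j k l + c k j l = 0"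
    using A C by (simp add: forall_3 add.commute)
  then show "\<And>j k l. j \<noteq> k \<Longrightarrow> k \<noteq> l \<Longrightarrow> j \<noteq> l \<Longrightarrow> c j k l + c k j l = 0" by blast
  show "c 1 1 1 + c 1 2 2 + c 2 1 2 + c 1 3 3 + c 3 1 3 = 0"
    "c 2 2 2 + c 1 2 1 + c 2 1 1 + c 2 3 3 + c 3 2 3 = 0"
    "c 3 3 3 + c 1 3 1 + c 3 1 1 + c 2 3 2 + c 3 2 2 = 0"
    using B C by blast+
qed

text \<open>A zero is a minimum along the complex line, so the linear term must vanish; otherwise a
  small step in the direction \<open>- B\<close> makes the form negative.\<close>

lemma sesq_eq_zero_if_nonneg_along_line:
  assumes herm: "adjoint_mat H = H"
    and nonneg: "\<And>c. 0 \<le> Re (sesq H (z + c *s v) (z + c *s v))"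
    and zero: "Re (sesq H z z) = 0"
  shows "sesq H v z = 0"
proof (rule ccontr)
  define B where "B = sesq H v z"
  assume "sesq H v z \<noteq> 0"
  then have B: "0 < (cmod B)\<^sup>2" by (simp add: B_def)
  have cB: "sesq H z v = cnj B" using cnj_sesq[of H v z] herm by (simp add: B_def)
  \<comment> \<open>Small enough that the quadratic term \<open>r^2 |B|^2 Re (sesq H v v)\<close> is
    at most half of the linear gain \<open>2 r |B|^2\<close>.\<close>
  define r where "r = 1 / (1 + \<bar>Re (sesq H v v)\<bar>)"
  have r: "0 < r" "r * Re (sesq H v v) \<le> 1"
    by (auto simp: r_def field_simps add_pos_nonneg)
  have BB: "complex_of_real (cmod B) * complex_of_real (cmod B) = B * cnj B"
    using complex_norm_square[of B] by (simp add: power2_eq_square)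
  have BB': "complex_of_real (cmod B) * (complex_of_real (cmod B) * z) = B * (cnj B * z)" for z
    using BB by (simp flip: mult.assoc)
  define c where "c = - of_real r * B"
  have "sesq H (z + c *s v) (z + c *s v) = sesq H z z + c * cnj B + cnj c * B + cnj c * c * sesq H v v"
    by (simp add: sesq_add_left sesq_add_right sesq_scale_left sesq_scale_right cB B_def[symmetric] algebra_simps)
  also have "\<dots> = sesq H z z - of_real (2 * r * (cmod B)\<^sup>2) + of_real (r\<^sup>2 * (cmod B)\<^sup>2) * sesq H v v"
    by (simp add: c_def BB BB' power2_eq_square algebra_simps)
  finally have e: "sesq H (z + c *s v) (z + c *s v)
      = sesq H z z - of_real (2 * r * (cmod B)\<^sup>2) + of_real (r\<^sup>2 * (cmod B)\<^sup>2) * sesq H v v" .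
  have "Re (sesq H (z + c *s v) (z + c *s v))
      = - (2 * r * (cmod B)\<^sup>2) + r\<^sup>2 * (cmod B)\<^sup>2 * Re (sesq H v v)"
    unfolding e plus_complex.sel minus_complex.sel zero Re_complex_of_real
    by (simp only: times_complex.sel Re_complex_of_real Im_complex_of_real)
  then have "Re (sesq H (z + c *s v) (z + c *s v)) = r * (cmod B)\<^sup>2 * (r * Re (sesq H v v) - 2)"
    by (simp add: power2_eq_square algebra_simps)
  moreover have "r * (cmod B)\<^sup>2 * (r * Re (sesq H v v) - 2) < 0"
    using r B by (intro mult_pos_neg) auto
  ultimately show False using nonneg[of c] by simp
qed

lemma sesq_axis_left:
  "sesq H (tensor_vec (axis i 1) y) z
    = (\<Sum>j\<in>UNIV. \<Sum>k\<in>UNIV. \<Sum>l\<in>UNIV. cnj (y $ j) * H $ (i, j) $ (k, l) * z $ (k, l))"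
proof -
  have "sesq H (tensor_vec (axis i 1) y) z
    = (\<Sum>i'\<in>UNIV. if i' = i then \<Sum>j\<in>UNIV. \<Sum>k\<in>UNIV. \<Sum>l\<in>UNIV. cnj (y $ j) * H $ (i', j) $ (k, l) * z $ (k, l) else 0)"
    unfolding sesq_def sum_UNIV_prod tensor_vec_def axis_def by (intro sum.cong) auto
  then show ?thesis by simp
qed

text \<open>The sums are reordered so that, at a phase zero, the conjugated factor comes last, as
  \<open>cubic_trig_poly_coeffs\<close> expects.\<close>

lemma sesq_axis_right:
  "sesq H z (tensor_vec x (axis j 1))
    = (\<Sum>k\<in>UNIV. \<Sum>l\<in>UNIV. \<Sum>c\<in>UNIV. cnj (z $ (c, l)) * H $ (c, l) $ (k, j) * x $ k)"
proof -
  have "sesq H z (tensor_vec x (axis j 1))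
    = (\<Sum>c\<in>UNIV. \<Sum>l\<in>UNIV. \<Sum>k\<in>UNIV. \<Sum>j'\<in>UNIV. if j' = j then cnj (z $ (c, l)) * H $ (c, l) $ (k, j') * x $ k else 0)"
    unfolding sesq_def sum_UNIV_prod tensor_vec_def axis_def by (intro sum.cong) auto
  also have "\<dots> = (\<Sum>c\<in>UNIV. \<Sum>k\<in>UNIV. \<Sum>l\<in>UNIV. cnj (z $ (c, l)) * H $ (c, l) $ (k, j) * x $ k)"
    by (simp) (intro sum.cong refl sum.swap)
  also have "\<dots> = (\<Sum>k\<in>UNIV. \<Sum>c\<in>UNIV. \<Sum>l\<in>UNIV. cnj (z $ (c, l)) * H $ (c, l) $ (k, j) * x $ k)"
    by (rule sum.swap)
  also have "\<dots> = (\<Sum>k\<in>UNIV. \<Sum>l\<in>UNIV. \<Sum>c\<in>UNIV. cnj (z $ (c, l)) * H $ (c, l) $ (k, j) * x $ k)"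
    by (intro sum.cong refl sum.swap)
  finally show ?thesis .
qed

text \<open>Moving one tensor factor keeps the vector a product, so positivity on product vectors is
  enough for the first-order condition.\<close>

lemma block_positive_zero_left:
  assumes "adjoint_mat H = H" "\<And>x y. 0 \<le> Re (sesq H (tensor_vec x y) (tensor_vec x y))"
    and "Re (sesq H (tensor_vec x y) (tensor_vec x y)) = 0"
  shows "sesq H (tensor_vec u y) (tensor_vec x y) = 0"
proof (rule sesq_eq_zero_if_nonneg_along_line[OF assms(1) _ assms(3)])
  fix c
  have "tensor_vec x y + c *s tensor_vec u y = tensor_vec (x + c *s u) y"
    by (simp add: tensor_vec_def vec_eq_iff algebra_simps)
  then show "0 \<le> Re (sesq H (tensor_vec x y + c *s tensor_vec u y) (tensor_vec x y + c *s tensor_vec u y))"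
    using assms(2) by simp
qed

lemma block_positive_zero_right:
  assumes "adjoint_mat H = H" "\<And>x y. 0 \<le> Re (sesq H (tensor_vec x y) (tensor_vec x y))"
    and "Re (sesq H (tensor_vec x y) (tensor_vec x y)) = 0"
  shows "sesq H (tensor_vec x y) (tensor_vec x v) = 0"
proof -
  have "sesq H (tensor_vec x v) (tensor_vec x y) = 0"
  proof (rule sesq_eq_zero_if_nonneg_along_line[OF assms(1) _ assms(3)])
    fix c
    have "tensor_vec x y + c *s tensor_vec x v = tensor_vec x (y + c *s v)"
      by (simp add: tensor_vec_def vec_eq_iff algebra_simps)
    then show "0 \<le> Re (sesq H (tensor_vec x y + c *s tensor_vec x v) (tensor_vec x y + c *s tensor_vec x v))"
      using assms(2) by simp
  qed
  then show ?thesis using cnj_sesq[of H "tensor_vec x v" "tensor_vec x y"] assms(1) by simp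
qed

text \<open>
  The matrix with diagonal entries \<open>(b - 1)\<^sup>2, 1, b\<^sup>2\<close> in place of \<open>a, b, c\<close> and off-diagonal entries
  \<open>- (b\<^sup>2 - b + 1)\<close>, written through \<^const>\<open>A_mat\<close> so that its quadratic form is already known.
\<close>

definition choi_witness :: "real \<Rightarrow> mat33"
  where "choi_witness b = (- (b\<^sup>2 - b + 1)) *\<^sub>R A_mat
    (- ((b - 1)\<^sup>2 / (b\<^sup>2 - b + 1)), - (1 / (b\<^sup>2 - b + 1)), - (b\<^sup>2 / (b\<^sup>2 - b + 1)))"

lemma sesq_choi_witness:
  "Re (sesq (choi_witness b) (tensor_vec x y) (tensor_vec x y))
    = choi_form b (x $ 1) (x $ 2) (x $ 3) (y $ 1) (y $ 2) (y $ 3)"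
proof -
  define D where "D = b\<^sup>2 - b + 1"
  have D: "D \<noteq> 0" using choi_const_pos[of b] by (simp add: D_def)
  have c: "- D * ((- (p / D) - 1) * X + m + - (1 / D) * Y + - (q / D) * Z)
      = (p + D) * X - D * m + Y + q * Z" for p q X Y Z m
    using D by (simp add: field_simps)
  show ?thesis
    unfolding choi_witness_def sesq_scaleR_mat scaleR_complex.sel(1) Re_sesq_A_mat D_def[symmetric] c
    by (simp add: choi_form_def choi_denom_def D_def tensor_vec_def norm_mult power_mult_distrib
        algebra_simps)
qed

locale choi_supporting =
  fixes b :: real and H :: mat33
  assumes b: "0 < b" "b \<noteq> 1"
    and herm: "adjoint_mat H = H"
    and block_pos: "\<And>x y. 0 \<le> Re (sesq H (tensor_vec x y) (tensor_vec x y))"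
    and zeros: "\<And>z. z \<in> choi_zeros b \<Longrightarrow> Re (sesq H z z) = 0"
begin

text \<open>
  A zero of a block-positive form is a minimum in each tensor factor separately, so the first-order
  conditions there are linear in the entries of \<open>H\<close>. As trigonometric polynomials in the phases they
  split into one equation per monomial.
\<close>

lemma H_cnj: "H $ p $ q = cnj (H $ q $ p)"
proof -
  have "H $ p $ q = adjoint_mat H $ p $ q" by (simp add: herm)
  then show ?thesis by (simp add: adjoint_mat_def)
qed

lemma cnj_phase_vector:
  "(vector [1, cnj u, cnj v] :: complex ^ 3) $ j = cnj ((vector [1, u, v] :: complex ^ 3) $ j)"
  using exhaust_3[of j] by auto

lemma phase_left:
  assumes "cmod u = 1" "cmod v = 1"
  shows "(\<Sum>j\<in>UNIV. \<Sum>k\<in>UNIV. \<Sum>l\<in>UNIV. H $ (i, j) $ (k, l) *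
    (vector [1, u, v] $ j * vector [1, u, v] $ k * cnj (vector [1, u, v] $ l))) = 0"
proof -
  have "phase_zero u v \<in> choi_zeros b" using assms by (auto simp: choi_zeros_def)
  then have "sesq H (tensor_vec (axis i 1) (vector [1, cnj u, cnj v])) (phase_zero u v) = 0"
    using block_positive_zero_left[OF herm block_pos] zeros by (simp add: phase_zero_def)
  then show ?thesis
    unfolding sesq_axis_left unfolding phase_zero_def tensor_vec_def by (simp add: cnj_phase_vector mult_ac)
qed

lemma phase_right:
  assumes "cmod u = 1" "cmod v = 1"
  shows "(\<Sum>k\<in>UNIV. \<Sum>c\<in>UNIV. \<Sum>l\<in>UNIV. H $ (l, c) $ (k, j) *
    (vector [1, u, v] $ k * vector [1, u, v] $ c * cnj (vector [1, u, v] $ l))) = 0"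
proof -
  have "phase_zero u v \<in> choi_zeros b" using assms by (auto simp: choi_zeros_def)
  then have "sesq H (phase_zero u v) (tensor_vec (vector [1, u, v]) (axis j 1)) = 0"
    using block_positive_zero_right[OF herm block_pos] zeros by (simp add: phase_zero_def)
  then show ?thesis
    unfolding sesq_axis_right unfolding phase_zero_def tensor_vec_def by (simp add: cnj_phase_vector mult_ac)
qed

lemmas left_coeffs = cubic_trig_poly_coeffs[OF phase_left]
lemmas right_coeffs = cubic_trig_poly_coeffs[OF phase_right]

lemma sqrt_b: "complex_of_real (sqrt b) * complex_of_real (sqrt b) = of_real b" "complex_of_real (sqrt b) \<noteq> 0"
  using b by (simp_all flip: of_real_mult)

text \<open>These are the coefficients of \<open>u^0\<close> and \<open>u^1\<close> in the
  first-order condition at \<open>edge_zero1\<close>, cleared of powers of \<open>sqrt b\<close>.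
  The other two edges repeat this with the indices shifted cyclically.\<close>

lemma edge1_left:
  "of_real b * (H $ (i,1) $ (1,1) + H $ (i,1) $ (2,2)) + H $ (i,2) $ (1,2) = 0"
  "of_real b * H $ (i,1) $ (2,1) + (H $ (i,2) $ (1,1) + H $ (i,2) $ (2,2)) = 0"
proof -
  define s where "s = complex_of_real (sqrt b)"
  have s: "cnj s = s" "s * s = of_real b" "s \<noteq> 0" using sqrt_b by (simp_all add: s_def)
  have "s * H $ (i,1) $ (1,2) * cnj u
      + (s * s * (H $ (i,1) $ (1,1) + H $ (i,1) $ (2,2)) + H $ (i,2) $ (1,2))
      + s * (s * s * H $ (i,1) $ (2,1) + (H $ (i,2) $ (1,1) + H $ (i,2) $ (2,2))) * u
      + s * s * H $ (i,2) $ (2,1) * (u * u) = 0" if "cmod u = 1" for u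
  proof -
    have u: "u * cnj u = 1" using that complex_norm_square[of u] by simp
    have u': "u * (cnj u * z) = z" for z using u by (simp flip: mult.assoc)
    have "edge_zero1 b u \<in> choi_zeros b" using that by (auto simp: choi_zeros_def)
    then have "sesq H (tensor_vec (axis i 1) (vector [s, cnj u, 0])) (edge_zero1 b u) = 0"
      using block_positive_zero_left[OF herm block_pos] zeros by (simp add: edge_zero1_def s_def)
    then show ?thesis
      unfolding sesq_axis_left unfolding edge_zero1_def tensor_vec_def s_def[symmetric]
      by (simp add: sum_3 algebra_simps s(1) u u')
  qed
  from trig_poly_coeffs(2,3)[OF this]
  show "of_real b * (H $ (i,1) $ (1,1) + H $ (i,1) $ (2,2)) + H $ (i,2) $ (1,2) = 0"
    "of_real b * H $ (i,1) $ (2,1) + (H $ (i,2) $ (1,1) + H $ (i,2) $ (2,2)) = 0"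
    using s(2,3) by auto
qed

text \<open>For \<open>j = 1\<close>, comparison with the second equation of
  \<open>edge1_left\<close> at \<open>i = 2\<close> equates the entries at \<open>(1,1)\<close> and
  \<open>(2,2)\<close>.\<close>

lemma edge1_right: "of_real b * H $ (2,1) $ (2,j) + (H $ (1,1) $ (1,j) + H $ (2,2) $ (1,j)) = 0"
proof -
  define s where "s = complex_of_real (sqrt b)"
  have s: "cnj s = s" "s * s = of_real b" "s \<noteq> 0" using sqrt_b by (simp_all add: s_def)
  have "s * s * H $ (2,1) $ (1,j) * cnj u
      + s * (s * s * H $ (2,1) $ (2,j) + (H $ (1,1) $ (1,j) + H $ (2,2) $ (1,j)))
      + (H $ (1,2) $ (1,j) + s * s * (H $ (1,1) $ (2,j) + H $ (2,2) $ (2,j))) * u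
      + s * H $ (1,2) $ (2,j) * (u * u) = 0" if "cmod u = 1" for u
  proof -
    have u: "u * cnj u = 1" using that complex_norm_square[of u] by simp
    have u': "u * (cnj u * z) = z" for z using u by (simp flip: mult.assoc)
    have "edge_zero1 b u \<in> choi_zeros b" using that by (auto simp: choi_zeros_def)
    then have "sesq H (edge_zero1 b u) (tensor_vec (vector [1, s * u, 0]) (axis j 1)) = 0"
      using block_positive_zero_right[OF herm block_pos] zeros by (simp add: edge_zero1_def s_def)
    then show ?thesis
      unfolding sesq_axis_right unfolding edge_zero1_def tensor_vec_def s_def[symmetric]
      by (simp add: sum_3 algebra_simps s(1) u u')
  qed
  from trig_poly_coeffs(2)[OF this] show ?thesis
    using s(2,3) by auto
qed

lemma edge2_left:
  "of_real b * (H $ (i,2) $ (2,2) + H $ (i,2) $ (3,3)) + H $ (i,3) $ (2,3) = 0"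
  "of_real b * H $ (i,2) $ (3,2) + (H $ (i,3) $ (2,2) + H $ (i,3) $ (3,3)) = 0"
proof -
  define s where "s = complex_of_real (sqrt b)"
  have s: "cnj s = s" "s * s = of_real b" "s \<noteq> 0" using sqrt_b by (simp_all add: s_def)
  have "s * H $ (i,2) $ (2,3) * cnj u
      + (s * s * (H $ (i,2) $ (2,2) + H $ (i,2) $ (3,3)) + H $ (i,3) $ (2,3))
      + s * (s * s * H $ (i,2) $ (3,2) + (H $ (i,3) $ (2,2) + H $ (i,3) $ (3,3))) * u
      + s * s * H $ (i,3) $ (3,2) * (u * u) = 0" if "cmod u = 1" for u
  proof -
    have u: "u * cnj u = 1" using that complex_norm_square[of u] by simp
    have u': "u * (cnj u * z) = z" for z using u by (simp flip: mult.assoc)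
    have "edge_zero2 b u \<in> choi_zeros b" using that by (auto simp: choi_zeros_def)
    then have "sesq H (tensor_vec (axis i 1) (vector [0, s, cnj u])) (edge_zero2 b u) = 0"
      using block_positive_zero_left[OF herm block_pos] zeros by (simp add: edge_zero2_def s_def)
    then show ?thesis
      unfolding sesq_axis_left unfolding edge_zero2_def tensor_vec_def s_def[symmetric]
      by (simp add: sum_3 algebra_simps s(1) u u')
  qed
  from trig_poly_coeffs(2,3)[OF this]
  show "of_real b * (H $ (i,2) $ (2,2) + H $ (i,2) $ (3,3)) + H $ (i,3) $ (2,3) = 0"
    "of_real b * H $ (i,2) $ (3,2) + (H $ (i,3) $ (2,2) + H $ (i,3) $ (3,3)) = 0"
    using s(2,3) by auto
qed

lemma edge2_right: "of_real b * H $ (3,2) $ (3,j) + (H $ (2,2) $ (2,j) + H $ (3,3) $ (2,j)) = 0"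
proof -
  define s where "s = complex_of_real (sqrt b)"
  have s: "cnj s = s" "s * s = of_real b" "s \<noteq> 0" using sqrt_b by (simp_all add: s_def)
  have "s * s * H $ (3,2) $ (2,j) * cnj u
      + s * (s * s * H $ (3,2) $ (3,j) + (H $ (2,2) $ (2,j) + H $ (3,3) $ (2,j)))
      + (H $ (2,3) $ (2,j) + s * s * (H $ (2,2) $ (3,j) + H $ (3,3) $ (3,j))) * u
      + s * H $ (2,3) $ (3,j) * (u * u) = 0" if "cmod u = 1" for u
  proof -
    have u: "u * cnj u = 1" using that complex_norm_square[of u] by simp
    have u': "u * (cnj u * z) = z" for z using u by (simp flip: mult.assoc)
    have "edge_zero2 b u \<in> choi_zeros b" using that by (auto simp: choi_zeros_def)
    then have "sesq H (edge_zero2 b u) (tensor_vec (vector [0, 1, s * u]) (axis j 1)) = 0"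
      using block_positive_zero_right[OF herm block_pos] zeros by (simp add: edge_zero2_def s_def)
    then show ?thesis
      unfolding sesq_axis_right unfolding edge_zero2_def tensor_vec_def s_def[symmetric]
      by (simp add: sum_3 algebra_simps s(1) u u')
  qed
  from trig_poly_coeffs(2)[OF this] show ?thesis
    using s(2,3) by auto
qed

lemma edge3_left:
  "of_real b * (H $ (i,3) $ (3,3) + H $ (i,3) $ (1,1)) + H $ (i,1) $ (3,1) = 0"
  "of_real b * H $ (i,3) $ (1,3) + (H $ (i,1) $ (3,3) + H $ (i,1) $ (1,1)) = 0"
proof -
  define s where "s = complex_of_real (sqrt b)"
  have s: "cnj s = s" "s * s = of_real b" "s \<noteq> 0" using sqrt_b by (simp_all add: s_def)
  have "s * H $ (i,3) $ (3,1) * cnj u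
      + (s * s * (H $ (i,3) $ (3,3) + H $ (i,3) $ (1,1)) + H $ (i,1) $ (3,1))
      + s * (s * s * H $ (i,3) $ (1,3) + (H $ (i,1) $ (3,3) + H $ (i,1) $ (1,1))) * u
      + s * s * H $ (i,1) $ (1,3) * (u * u) = 0" if "cmod u = 1" for u
  proof -
    have u: "u * cnj u = 1" using that complex_norm_square[of u] by simp
    have u': "u * (cnj u * z) = z" for z using u by (simp flip: mult.assoc)
    have "edge_zero3 b u \<in> choi_zeros b" using that by (auto simp: choi_zeros_def)
    then have "sesq H (tensor_vec (axis i 1) (vector [cnj u, 0, s])) (edge_zero3 b u) = 0"
      using block_positive_zero_left[OF herm block_pos] zeros by (simp add: edge_zero3_def s_def)
    then show ?thesis
      unfolding sesq_axis_left unfolding edge_zero3_def tensor_vec_def s_def[symmetric]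
      by (simp add: sum_3 algebra_simps s(1) u u')
  qed
  from trig_poly_coeffs(2,3)[OF this]
  show "of_real b * (H $ (i,3) $ (3,3) + H $ (i,3) $ (1,1)) + H $ (i,1) $ (3,1) = 0"
    "of_real b * H $ (i,3) $ (1,3) + (H $ (i,1) $ (3,3) + H $ (i,1) $ (1,1)) = 0"
    using s(2,3) by auto
qed

lemma edge3_right: "of_real b * H $ (1,3) $ (1,j) + (H $ (3,3) $ (3,j) + H $ (1,1) $ (3,j)) = 0"
proof -
  define s where "s = complex_of_real (sqrt b)"
  have s: "cnj s = s" "s * s = of_real b" "s \<noteq> 0" using sqrt_b by (simp_all add: s_def)
  have "s * s * H $ (1,3) $ (3,j) * cnj u
      + s * (s * s * H $ (1,3) $ (1,j) + (H $ (3,3) $ (3,j) + H $ (1,1) $ (3,j)))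
      + (H $ (3,1) $ (3,j) + s * s * (H $ (3,3) $ (1,j) + H $ (1,1) $ (1,j))) * u
      + s * H $ (3,1) $ (1,j) * (u * u) = 0" if "cmod u = 1" for u
  proof -
    have u: "u * cnj u = 1" using that complex_norm_square[of u] by simp
    have u': "u * (cnj u * z) = z" for z using u by (simp flip: mult.assoc)
    have "edge_zero3 b u \<in> choi_zeros b" using that by (auto simp: choi_zeros_def)
    then have "sesq H (edge_zero3 b u) (tensor_vec (vector [s * u, 0, 1]) (axis j 1)) = 0"
      using block_positive_zero_right[OF herm block_pos] zeros by (simp add: edge_zero3_def s_def)
    then show ?thesis
      unfolding sesq_axis_right unfolding edge_zero3_def tensor_vec_def s_def[symmetric]
      by (simp add: sum_3 algebra_simps s(1) u u')
  qed
  from trig_poly_coeffs(2)[OF this] show ?thesis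
    using s(2,3) by auto
qed

section \<open>Vanishing of the entries outside the pattern of \<open>A[a, b, c]\<close>\<close>

lemma H_jj: "j \<noteq> l \<Longrightarrow> H $ (i, j) $ (j, l) = 0"
  by (rule left_coeffs(1))

lemma H_aa: "a \<noteq> l \<Longrightarrow> H $ (l, a) $ (a, j) = 0"
  by (rule right_coeffs(1))

lemma H_swap_left: "j \<noteq> k \<Longrightarrow> k \<noteq> l \<Longrightarrow> j \<noteq> l \<Longrightarrow> H $ (i, k) $ (j, l) = - H $ (i, j) $ (k, l)"
  by (rule left_coeffs(2)[THEN add_eq_0_iff[THEN iffD1]])

lemma H_swap_right: "a \<noteq> c \<Longrightarrow> c \<noteq> l \<Longrightarrow> a \<noteq> l \<Longrightarrow> H $ (l, a) $ (c, j) = - H $ (l, c) $ (a, j)"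
  by (rule right_coeffs(2)[THEN add_eq_0_iff[THEN iffD1]])

text \<open>The phase conditions turn the edge equation into
  \<open>(b - 1) * H $ (t,p) $ (r,r) = 0\<close>; they alone only relate this entry to others by
  sign. The entry with \<open>p\<close> and \<open>t\<close> exchanged follows from two swaps and
  Hermitian symmetry.\<close>

lemma H_cyclic_zero:
  assumes "of_real b * (H $ (t,p) $ (p,p) + H $ (t,p) $ (r,r)) + H $ (t,r) $ (p,r) = 0"
    and "p \<noteq> r" "r \<noteq> t" "p \<noteq> t"
  shows "H $ (t,p) $ (r,r) = 0" "H $ (p,t) $ (r,r) = 0"
proof -
  have "H $ (t,p) $ (p,p) = 0" using H_aa[of p t p] assms(4) by simp
  moreover have "H $ (t,r) $ (p,r) = - H $ (t,p) $ (r,r)"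
    using H_swap_right[of r p t r] assms by auto
  ultimately have "(of_real b - 1) * H $ (t,p) $ (r,r) = 0"
    using assms(1) by (simp add: algebra_simps)
  moreover have "complex_of_real b \<noteq> 1" using b by simp
  ultimately show 0: "H $ (t,p) $ (r,r) = 0" by simp
  have "H $ (r,t) $ (r,p) = - H $ (r,r) $ (t,p)"
    using H_swap_left[of r t p r] assms by auto
  then have "H $ (r,t) $ (r,p) = 0" using 0 H_cnj[of "(r,r)" "(t,p)"] by simp
  then have "H $ (r,p) $ (r,t) = 0" using H_cnj[of "(r,p)" "(r,t)"] by simp
  moreover have "H $ (r,p) $ (r,t) = - H $ (r,r) $ (p,t)"
    using H_swap_left[of r p t r] assms by auto
  ultimately show "H $ (p,t) $ (r,r) = 0"
    using H_cnj[of "(p,t)" "(r,r)"] by simp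
qed

lemma H_distinct_zero:
  assumes "i \<noteq> k" "k \<noteq> l" "i \<noteq> l"
  shows "H $ (k, l) $ (i, i) = 0"
proof -
  have "\<forall>i k l. i \<noteq> k \<longrightarrow> k \<noteq> l \<longrightarrow> i \<noteq> l \<longrightarrow> H $ (k, l) $ (i, i) = 0"
    using H_cyclic_zero[OF edge1_left(1)[of 3]] H_cyclic_zero[OF edge2_left(1)[of 1]]
      H_cyclic_zero[OF edge3_left(1)[of 2]] by (simp add: forall_3)
  then show ?thesis using assms by blast
qed

lemma H_zero:
  assumes "(i, j) \<noteq> (k, l)" "\<not> (i = j \<and> k = l)"
  shows "H $ (i, j) $ (k, l) = 0"
proof -
  \<comment> \<open>Only three indices exist, so two that both avoid \<open>i\<close> and
    \<open>k\<close> coincide.\<close>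
  have third: "l = j" if "i \<noteq> j" "i \<noteq> k" "j \<noteq> k" "l \<noteq> k" "l \<noteq> i"
  proof -
    have "\<forall>i j k l :: 3. i \<noteq> j \<longrightarrow> i \<noteq> k \<longrightarrow> j \<noteq> k \<longrightarrow> l \<noteq> k \<longrightarrow> l \<noteq> i \<longrightarrow> l = j"
      by (simp add: forall_3)
    then show ?thesis using that by blast
  qed
  consider "j = k" | "i = l" | "j \<noteq> k" "i \<noteq> l" by blast
  then show ?thesis
  proof cases
    case 1
    then show ?thesis using assms H_jj[of j l i] H_aa[of j i l] by auto
  next
    case 2
    then have "H $ (k, l) $ (i, j) = 0" using assms H_jj[of l j k] H_aa[of i k j] by auto
    then show ?thesis using H_cnj[of "(i, j)" "(k, l)"] by simp
  next
    case 3
    show ?thesis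
    proof (cases "i = j \<or> k = l")
      case True
      then have "H $ (i, j) $ (k, l) = 0 \<or> H $ (k, l) $ (i, j) = 0"
        using assms 3 H_distinct_zero[of i k l] H_distinct_zero[of k i j] by auto
      then show ?thesis using H_cnj[of "(i, j)" "(k, l)"] by auto
    next
      case False
      show ?thesis
      proof (cases "i = k")
        case True
        then have "H $ (i, j) $ (i, l) = - H $ (i, i) $ (j, l)"
          using assms 3 False by (intro H_swap_left) auto
        moreover have "H $ (j, l) $ (i, i) = 0"
          using assms 3 False True by (intro H_distinct_zero) auto
        ultimately show ?thesis using True H_cnj[of "(i, i)" "(j, l)"] by simp
      next
        case ik: False
        then have "l = j" using 3 False by (intro third) auto
        then have "H $ (i, j) $ (k, l) = - H $ (i, k) $ (j, j)"
          using H_swap_right[of j k i j] 3 False ik by auto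
        moreover have "H $ (i, k) $ (j, j) = 0"
          using 3 False ik by (intro H_distinct_zero) auto
        ultimately show ?thesis by simp
      qed
    qed
  qed
qed

section \<open>Determination of the remaining entries\<close>

lemma H_diag_real: "\<exists>r. H $ p $ p = complex_of_real r"
  using H_cnj[of p p] by (intro exI[of _ "Re (H $ p $ p)"]) (simp add: complex_eq_iff)

text \<open>On one coordinate plane the edge equations leave two real parameters, \<open>a\<close>
  and \<open>g\<close>.\<close>

lemma edge_weights:
  assumes "of_real b * (H $ (p,p) $ (p,p) + H $ (p,p) $ (r,r)) + H $ (p,r) $ (p,r) = 0"
    and "of_real b * H $ (r,p) $ (r,p) + (H $ (r,r) $ (p,p) + H $ (r,r) $ (r,r)) = 0"
    and "of_real b * H $ (r,p) $ (r,p) + (H $ (p,p) $ (p,p) + H $ (r,r) $ (p,p)) = 0"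
  obtains a g where "H $ (p,p) $ (p,p) = complex_of_real a" "H $ (r,r) $ (r,r) = of_real a"
    "H $ (r,p) $ (r,p) = of_real g" "H $ (p,r) $ (p,r) = of_real (b\<^sup>2 * g)"
    "H $ (p,p) $ (r,r) = of_real (- (a + b * g))" "H $ (r,r) $ (p,p) = of_real (- (a + b * g))"
proof -
  obtain a g where a: "H $ (p,p) $ (p,p) = complex_of_real a" and g: "H $ (r,p) $ (r,p) = of_real g"
    using H_diag_real by blast
  have eq: "H $ (r,r) $ (r,r) = H $ (p,p) $ (p,p)" using assms(2,3) by algebra
  have e: "H $ (r,r) $ (p,p) = of_real (- (a + b * g))"
    using assms(3) unfolding a g by (simp add: algebra_simps add_eq_0_iff)
  then have e': "H $ (p,p) $ (r,r) = of_real (- (a + b * g))"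
    using H_cnj[of "(p,p)" "(r,r)"] by simp
  have "H $ (p,r) $ (p,r) = of_real (b\<^sup>2 * g)"
    using assms(1) unfolding a e' by (simp add: algebra_simps power2_eq_square)
  with a g e e' eq that show thesis by simp
qed

lemma H_eq_choi_witness: "\<exists>r. H = r *\<^sub>R choi_witness b"
proof -
  obtain a g where e1: "H $ (1,1) $ (1,1) = complex_of_real a" "H $ (2,2) $ (2,2) = of_real a"
    "H $ (2,1) $ (2,1) = of_real g" "H $ (1,2) $ (1,2) = of_real (b\<^sup>2 * g)"
    "H $ (1,1) $ (2,2) = of_real (- (a + b * g))" "H $ (2,2) $ (1,1) = of_real (- (a + b * g))"
    using edge_weights[OF edge1_left(1) edge1_left(2) edge1_right] by blast
  obtain a' g' where "H $ (2,2) $ (2,2) = complex_of_real a'" "H $ (3,3) $ (3,3) = of_real a'"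
    "H $ (3,2) $ (3,2) = of_real g'" "H $ (2,3) $ (2,3) = of_real (b\<^sup>2 * g')"
    "H $ (2,2) $ (3,3) = of_real (- (a' + b * g'))" "H $ (3,3) $ (2,2) = of_real (- (a' + b * g'))"
    using edge_weights[OF edge2_left(1) edge2_left(2) edge2_right] by blast
  moreover have "a' = a" using calculation(1) e1(2) by simp
  ultimately have e2: "H $ (3,3) $ (3,3) = of_real a"
    "H $ (3,2) $ (3,2) = of_real g'" "H $ (2,3) $ (2,3) = of_real (b\<^sup>2 * g')"
    "H $ (2,2) $ (3,3) = of_real (- (a + b * g'))" "H $ (3,3) $ (2,2) = of_real (- (a + b * g'))"
    by simp_all
  obtain a' g'' where "H $ (3,3) $ (3,3) = complex_of_real a'" "H $ (1,1) $ (1,1) = of_real a'"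
    "H $ (1,3) $ (1,3) = of_real g''" "H $ (3,1) $ (3,1) = of_real (b\<^sup>2 * g'')"
    "H $ (3,3) $ (1,1) = of_real (- (a' + b * g''))" "H $ (1,1) $ (3,3) = of_real (- (a' + b * g''))"
    using edge_weights[OF edge3_left(1) edge3_left(2) edge3_right] by blast
  moreover have "a' = a" using calculation(2) e1(1) by simp
  ultimately have e3: "H $ (1,3) $ (1,3) = of_real g''" "H $ (3,1) $ (3,1) = of_real (b\<^sup>2 * g'')"
    "H $ (3,3) $ (1,1) = of_real (- (a + b * g''))" "H $ (1,1) $ (3,3) = of_real (- (a + b * g''))"
    by simp_all
  note l = left_coeffs(3)[of 1] left_coeffs(4)[of 2] left_coeffs(5)[of 3]
    right_coeffs(3)[of 1] right_coeffs(4)[of 2] right_coeffs(5)[of 3]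
  have L: "a - (a + b * g) + b\<^sup>2 * g - (a + b * g'') + g'' = 0"
      "a - (a + b * g) + g - (a + b * g') + b\<^sup>2 * g' = 0"
      "a - (a + b * g'') + b\<^sup>2 * g'' - (a + b * g') + g' = 0"
      "a - (a + b * g) + g - (a + b * g'') + b\<^sup>2 * g'' = 0"
      "a - (a + b * g) + b\<^sup>2 * g - (a + b * g') + g' = 0"
      "a - (a + b * g'') + g'' - (a + b * g') + b\<^sup>2 * g' = 0"
    using l unfolding e1 e2 e3 of_real_add[symmetric] of_real_eq_0_iff
    by linarith+
  have b2: "b\<^sup>2 - 1 \<noteq> 0" using b by (simp add: power2_eq_1_iff)
  \<comment> \<open>The left and right conditions for the same index differ by exchanging the
    weights \<open>g\<close> and \<open>b^2 g\<close> of each edge, so subtracting them links the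
    parameters of two edges.\<close>
  have "(b\<^sup>2 - 1) * (g - g'') = 0" using L(1,4) by algebra
  then have g1: "g'' = g" using b2 by simp
  have "(b\<^sup>2 - 1) * (g - g') = 0" using L(2,5) by algebra
  then have g2: "g' = g" using b2 by simp
  have a: "a = g * (b - 1)\<^sup>2" using L(1) unfolding g1 by algebra
  define D where "D = b\<^sup>2 - b + 1"
  have D: "D \<noteq> 0" using choi_const_pos[of b] by (simp add: D_def)
  have e: "- (a + b * g) = - (g * D)" unfolding a D_def by algebra
  note entries = e1[unfolded e] e2[unfolded g2 e] e3[unfolded g1 e]
  have "H = g *\<^sub>R choi_witness b"
    unfolding choi_witness_def D_def[symmetric]
    using D by (simp add: vec_eq_iff forall_3 A_mat_def entries H_zero a
        scaleR_conv_of_real[where 'a = complex])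
  then show ?thesis ..
qed

end

section \<open>Maximality of the face\<close>

lemma inner_rank_one: "w \<bullet> rank_one z = Re (sesq w z z)"
  unfolding inner_vec_def sesq_def rank_one_def Re_sum
  by (intro sum.cong refl) (simp add: inner_complex_def algebra_simps)

lemma rank_one_scale: "rank_one (k *s z) = (cmod k)\<^sup>2 *\<^sub>R rank_one z"
  using complex_norm_square[of k]
  by (simp add: rank_one_def vec_eq_iff scaleR_conv_of_real[where 'a = complex] mult_ac)

lemma choi_form_zero_imp:
  assumes "0 < b" "b \<noteq> 1" and nz: "tensor_vec x y \<noteq> 0"
    and zero: "choi_form b (x $ 1) (x $ 2) (x $ 3) (y $ 1) (y $ 2) (y $ 3) = 0"
  shows "\<exists>k. \<exists>z\<in>choi_zeros b. tensor_vec x y = k *s z"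
proof -
  have nz': "x $ 1 \<noteq> 0 \<or> x $ 2 \<noteq> 0 \<or> x $ 3 \<noteq> 0" "y $ 1 \<noteq> 0 \<or> y $ 2 \<noteq> 0 \<or> y $ 3 \<noteq> 0"
    using nz by (auto simp: tensor_vec_def vec_eq_iff forall_3)
  have phase: ?thesis if "cmod u = 1" "cmod v = 1" "x $ 1 = c" "x $ 2 = c * u" "x $ 3 = c * v"
      "y $ 1 = k" "y $ 2 = k * cnj u" "y $ 3 = k * cnj v" for c k u v
    using that by (intro exI[of _ "c * k"] bexI[of _ "phase_zero u v"])
      (auto simp: phase_zero_def tensor_vec_def vec_eq_iff forall_3 choi_zeros_def)
  have edge1: ?thesis if "cmod u = 1" "x $ 1 = c" "x $ 2 = c * (of_real (sqrt b) * u)" "x $ 3 = 0"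
      "y $ 1 = k * of_real (sqrt b)" "y $ 2 = k * cnj u" "y $ 3 = 0" for c k u
    using that by (intro exI[of _ "c * k"] bexI[of _ "edge_zero1 b u"])
      (auto simp: edge_zero1_def tensor_vec_def vec_eq_iff forall_3 choi_zeros_def)
  have edge2: ?thesis if "cmod u = 1" "x $ 2 = c" "x $ 3 = c * (of_real (sqrt b) * u)" "x $ 1 = 0"
      "y $ 2 = k * of_real (sqrt b)" "y $ 3 = k * cnj u" "y $ 1 = 0" for c k u
    using that by (intro exI[of _ "c * k"] bexI[of _ "edge_zero2 b u"])
      (auto simp: edge_zero2_def tensor_vec_def vec_eq_iff forall_3 choi_zeros_def)
  have edge3: ?thesis if "cmod u = 1" "x $ 3 = c" "x $ 1 = c * (of_real (sqrt b) * u)" "x $ 2 = 0"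
      "y $ 3 = k * of_real (sqrt b)" "y $ 1 = k * cnj u" "y $ 2 = 0" for c k u
    using that by (intro exI[of _ "c * k"] bexI[of _ "edge_zero3 b u"])
      (auto simp: edge_zero3_def tensor_vec_def vec_eq_iff forall_3 choi_zeros_def)
  \<comment> \<open>The cyclic shift normalizes another coordinate; multiplying by a conjugate phase
    restores the first entry to 1.\<close>
  have phase2: ?thesis if "cmod u = 1" "cmod v = 1" "x $ 2 = c" "x $ 3 = c * u" "x $ 1 = c * v"
      "y $ 2 = k" "y $ 3 = k * cnj u" "y $ 1 = k * cnj v" for c k u v
    using that complex_norm_square[of v]
    by (intro phase[of "cnj v" "u * cnj v" "c * v" "k * cnj v"]) (auto simp: norm_mult mult_ac)
  have phase3: ?thesis if "cmod u = 1" "cmod v = 1" "x $ 3 = c" "x $ 1 = c * u" "x $ 2 = c * v"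
      "y $ 3 = k" "y $ 1 = k * cnj u" "y $ 2 = k * cnj v" for c k u v
    using that complex_norm_square[of u]
    by (intro phase[of "v * cnj u" "cnj u" "c * u" "k * cnj u"]) (auto simp: norm_mult mult_ac)
  consider "cmod (x $ 3) \<le> cmod (x $ 1) \<and> cmod (x $ 3) \<le> cmod (x $ 2)"
    | "cmod (x $ 1) \<le> cmod (x $ 2) \<and> cmod (x $ 1) \<le> cmod (x $ 3)"
    | "cmod (x $ 2) \<le> cmod (x $ 3) \<and> cmod (x $ 2) \<le> cmod (x $ 1)" by linarith
  then show ?thesis
  proof cases
    case 1
    then show ?thesis
      using choi_form_zero_aux[OF assms(1,2) _ _ nz' zero] phase edge1 by blast
  next
    case 2
    have "choi_form b (x $ 2) (x $ 3) (x $ 1) (y $ 2) (y $ 3) (y $ 1) = 0"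
      using zero choi_form_cyclic[of b "x $ 1"] by simp
    from choi_form_zero_aux[OF assms(1,2) _ _ _ _ this] show ?thesis
      using 2 nz' phase2 edge2 by blast
  next
    case 3
    have "choi_form b (x $ 3) (x $ 1) (x $ 2) (y $ 3) (y $ 1) (y $ 2) = 0"
      using zero choi_form_cyclic[of b "x $ 3"] by simp
    from choi_form_zero_aux[OF assms(1,2) _ _ _ _ this] show ?thesis
      using 3 nz' phase3 edge3 by blast
  qed
qed

text \<open>The bracket equals \<open>2 * (b^2 - b + 1)\<close> both at \<open>(1, 1, 1)\<close> and
  at \<open>(2, b, 1/b)\<close>, so the witness annihilates the whole segment between them.\<close>

lemma inner_choi_witness_A_mat:
  "choi_witness b \<bullet> A_mat (a, b', c) = 3 * ((b - 1)\<^sup>2 * a + b' + b\<^sup>2 * c) - 6 * (b\<^sup>2 - b + 1)"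
proof -
  define D where "D = b\<^sup>2 - b + 1"
  have D: "D \<noteq> 0" using choi_const_pos[of b] by (simp add: D_def)
  show ?thesis
    unfolding choi_witness_def D_def[symmetric] inner_scaleR_left
    using D by (simp add: inner_vec_def sum_UNIV_prod sum_3 A_mat_def inner_complex_def field_simps)
qed

lemma V1_cases:
  assumes "A \<in> V1"
  obtains n x y where "A = (\<Sum>k<(n::nat). rank_one (tensor_vec (x k) (y k)))"
  using assms unfolding V1_def by blast

lemma inner_choi_witness_nonneg:
  assumes "0 < b" "A \<in> V1"
  shows "0 \<le> choi_witness b \<bullet> A"
  using assms(2)
proof (cases rule: V1_cases)
  case (1 n x y)
  then show ?thesis
    by (simp add: inner_sum_right inner_rank_one sesq_choi_witness choi_form_nonneg[OF assms(1)] sum_nonneg)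
qed

lemma zero_level_face_of_V1:
  assumes "\<And>A. A \<in> V1 \<Longrightarrow> 0 \<le> w \<bullet> A"
  shows "(V1 \<inter> {A. w \<bullet> A = 0}) face_of V1"
  using assms convex_cone_V1
  by (intro face_of_Int_supporting_hyperplane_ge) (auto simp: convex_cone_def)

lemma face_of_V1_contains_zeros:
  assumes b: "0 < b" "b \<noteq> 1" and s: "0 < s" "s < 1" and F: "F face_of V1"
    and mem: "A_mat ((1 - s) *\<^sub>R (1, 1, 1) + s *\<^sub>R (2, b, 1 / b)) \<in> F"
    and zero: "choi_witness b \<bullet> rank_one (tensor_vec x y) = 0"
  shows "rank_one (tensor_vec x y) \<in> F"
proof (cases "tensor_vec x y = 0")
  case True
  have "0 \<in> F"
    using face_of_cone_addD(2)[OF F convex_cone_V1, of _ 0] mem face_of_imp_subset[OF F]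
      convex_cone_contains_0[OF convex_cone_V1] by fastforce
  then show ?thesis using True by (simp add: rank_one_def zero_vec_def)
next
  case False
  then obtain k z where z: "z \<in> choi_zeros b" and k: "tensor_vec x y = k *s z"
    using choi_form_zero_imp[OF b False] zero by (auto simp: inner_rank_one sesq_choi_witness)
  have "k \<noteq> 0" using False k by auto
  then show ?thesis
    unfolding k rank_one_scale
    using choi_zeros_in_face[OF F b(1) s mem z] by (intro face_of_cone_scaleR[OF F convex_cone_V1]) auto
qed

lemma supporting_functional_kills_zeros_of_choi_witness:
  assumes b: "0 < b" "b \<noteq> 1" and s: "0 < s" "s < 1"
    and nonneg: "\<And>A. A \<in> V1 \<Longrightarrow> 0 \<le> w \<bullet> A"
    and pos: "\<exists>A\<in>V1. 0 < w \<bullet> A"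
    and zero: "w \<bullet> A_mat ((1 - s) *\<^sub>R (1, 1, 1) + s *\<^sub>R (2, b, 1 / b)) = 0"
    and mem: "A_mat ((1 - s) *\<^sub>R (1, 1, 1) + s *\<^sub>R (2, b, 1 / b)) \<in> V1"
    and wz: "w \<bullet> rank_one (tensor_vec x y) = 0"
  shows "choi_witness b \<bullet> rank_one (tensor_vec x y) = 0"
proof -
  \<comment> \<open>A real functional on all matrices need not be given by a Hermitian
    \<open>w\<close>; symmetrizing only doubles its values on the matrices
    \<open>rank_one z\<close>.\<close>
  define H where "H = w + adjoint_mat w"
  have H: "Re (sesq H z z) = 2 * (w \<bullet> rank_one z)" for z
    using arg_cong[OF cnj_sesq[of w z z], of Re] by (simp add: H_def sesq_add_mat inner_rank_one)
  have face: "(V1 \<inter> {A. w \<bullet> A = 0}) face_of V1" using nonneg by (rule zero_level_face_of_V1)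
  interpret choi_supporting b H
  proof
    show "adjoint_mat H = H" by (simp add: H_def adjoint_mat_def vec_eq_iff)
    show "0 \<le> Re (sesq H (tensor_vec x y) (tensor_vec x y))" for x y
      unfolding H using nonneg[OF rank_one_tensor_in_V1] by simp
    show "Re (sesq H z z) = 0" if "z \<in> choi_zeros b" for z
      unfolding H using choi_zeros_in_face[OF face b(1) s _ that] zero mem by simp
  qed (use b in auto)
  obtain r where r: "H = r *\<^sub>R choi_witness b" using H_eq_choi_witness by blast
  have w: "2 * (w \<bullet> rank_one z) = r * (choi_witness b \<bullet> rank_one z)" for z
    using H[of z] unfolding r by (simp add: sesq_scaleR_mat inner_rank_one)
  have "r \<noteq> 0"
  proof
    assume "r = 0"
    then have w0: "w \<bullet> rank_one z = 0" for z using w[of z] by simp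
    obtain A where "A \<in> V1" "0 < w \<bullet> A" using pos by blast
    then show False by (cases rule: V1_cases) (simp add: inner_sum_right w0)
  qed
  then show ?thesis using w[of "tensor_vec x y"] wz by simp
qed

theorem mainTheorem2:
  fixes b s :: real and v1 vb eb :: "real \<times> real \<times> real"
  assumes "b > 0" and "b \<noteq> 1" and "0 < s" and "s < 1"
    and "v1 = (1, 1, 1)" and "vb = (2, b, 1 / b)"
    and "eb = (1 - s) *\<^sub>R v1 + s *\<^sub>R vb"
  shows "mat_range (A_mat eb) = UNIV
    \<and> mat_range (partial_transpose (A_mat eb)) = UNIV
    \<and> A_mat eb \<in> rel_interior PPT
    \<and> smallest_face V1 (A_mat eb) proper_face_of V1
    \<and> rel_interior (smallest_face V1 (A_mat eb)) \<subseteq> rel_interior PPT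
    \<and> smallest_face V1 (A_mat eb) maximal_face_of V1
    \<and> A_mat eb \<in> V1
    \<and> A_mat eb \<in> boundary_of_convex V1"
proof -
  note b = assms(1,2) and s = assms(3,4)
  have eb: "eb = (1 - s) *\<^sub>R (1, 1, 1) + s *\<^sub>R (2, b, 1 / b)" using assms(5-7) by simp
  define A where "A = A_mat eb"
  define F where "F = smallest_face V1 A"
  let ?W = "choi_witness b"
  note cone = convex_cone_V1
  have conv: "convex V1" using cone by (simp add: convex_cone_def)

  have AV1: "A \<in> V1"
    unfolding A_def eb A_mat_convex_comb
    using s b A_mat_111_in_V1 A_mat_2b_in_V1 by (intro V1_add V1_scaleR) auto

  have coords: "eb = (1 + s, 1 - s + s * b, 1 - s + s / b)"
    by (simp add: eb)
  \<comment> \<open>Strict AM-GM: although \<open>v_1\<close> and \<open>v_b\<close> both have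
    second times third coordinate equal to 1, interior points of the segment exceed it.\<close>
  have "0 < (b - 1)\<^sup>2" using b by simp
  then have "2 < b + 1 / b" using b(1) by (simp add: field_simps power2_eq_square)
  then have "s * (1 - s) * 2 < s * (1 - s) * (b + 1 / b)" using s by (intro mult_strict_left_mono) auto
  moreover have "(1 - s + s * b) * (1 - s + s / b) = (1 - s)\<^sup>2 + s\<^sup>2 + s * (1 - s) * (b + 1 / b)"
    using b(1) by (simp add: field_simps power2_eq_square)
  moreover have "(1 - s)\<^sup>2 + s\<^sup>2 + s * (1 - s) * 2 = 1" by (simp add: algebra_simps power2_eq_square)
  ultimately have "1 < (1 - s + s * b) * (1 - s + s / b)" by linarith
  then obtain d where d: "0 < d" "\<And>x. d * (norm x)\<^sup>2 \<le> Re (sesq A x x)"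
      "\<And>x. d * (norm x)\<^sup>2 \<le> Re (sesq (partial_transpose A) x x)"
    unfolding A_def coords using s b(1)
    by (elim A_mat_pos_def[rotated 3]) (auto intro: add_pos_pos)
  have range: "mat_range A = UNIV" "mat_range (partial_transpose A) = UNIV"
    using mat_range_UNIV_if_pos_def d by blast+
  have PPT: "A \<in> rel_interior PPT"
    using d by (intro rel_interior_PPT_if_pos_def) (auto simp: A_def adjoint_A_mat)

  have F_eq: "F = \<Inter> {T. T face_of V1 \<and> A \<in> T}"
    by (simp add: F_def smallest_face_def hull_def)
  have F_face: "F face_of V1"
    unfolding F_eq using face_of_refl[OF conv] AV1 by (intro face_of_Inter) auto
  have AF: "A \<in> F" by (simp add: F_eq)
  have F_least: "F \<subseteq> T" if "T face_of V1" "A \<in> T" for T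
    using that by (auto simp: F_eq)

  have WA: "?W \<bullet> A = 0"
    unfolding A_def coords inner_choi_witness_A_mat
    using b(1) by (simp add: field_simps power2_eq_square)
  have "F \<subseteq> V1 \<inter> {B. ?W \<bullet> B = 0}"
    using WA AV1 inner_choi_witness_nonneg[OF b(1)] by (intro F_least zero_level_face_of_V1) auto
  \<comment> \<open>The value is \<open>(b - 1)^2\<close>, so the face cut out by the witness is
    proper.\<close>
  moreover have "0 < ?W \<bullet> rank_one (tensor_vec (axis 1 1) (axis 1 1))"
    using b by (simp add: inner_rank_one sesq_choi_witness choi_form_def choi_denom_def axis_def)
  ultimately have F_proper: "F \<noteq> V1"
    using rank_one_tensor_in_V1[of "axis 1 1" "axis 1 1"] by force

  have bdry: "A \<notin> rel_interior V1"
    using face_of_disjoint_rel_interior[OF F_face F_proper] AF by auto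

  have max: "G \<subseteq> F" if G: "G face_of V1" "G \<noteq> V1" "F \<subseteq> G" for G
  proof
    fix B assume B: "B \<in> G"
    then obtain n x y where Bs: "B = (\<Sum>k<(n::nat). rank_one (tensor_vec (x k) (y k)))"
      using face_of_imp_subset[OF G(1)] V1_cases by blast
    have "rank_one (tensor_vec (x k) (y k)) \<in> F" if "k < n" for k
    proof -
      let ?Z = "rank_one (tensor_vec (x k) (y k))"
      have "?Z \<in> G"
        using face_of_cone_sumD[OF G(1) cone finite_lessThan _ B[unfolded Bs], of k] that
        by (simp add: rank_one_tensor_in_V1)
      \<comment> \<open>Adding \<open>A\<close> forces the functional found below to vanish at
        \<open>A\<close> as well as at the product state under test.\<close>
      then have M: "A + ?Z \<in> G" using face_of_cone_add[OF G(1) cone] AF G(3) by blast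
      then have "A + ?Z \<notin> rel_interior V1"
        using face_of_disjoint_rel_interior[OF G(1,2)] by auto
      moreover have MV: "A + ?Z \<in> V1" using M face_of_imp_subset[OF G(1)] by blast
      ultimately obtain w where w: "\<And>C. C \<in> V1 \<Longrightarrow> w \<bullet> (A + ?Z) \<le> w \<bullet> C"
          "\<And>C. C \<in> rel_interior V1 \<Longrightarrow> w \<bullet> (A + ?Z) < w \<bullet> C"
        using supporting_hyperplane_rel_boundary[OF conv] by blast
      \<comment> \<open>On a cone an attained minimum is 0: compare with the points \<open>0\<close>
        and \<open>2 (A + ?Z)\<close>.\<close>
      have "w \<bullet> (A + ?Z) \<le> 0"
        using w(1)[OF convex_cone_contains_0[OF cone]] by simp
      moreover have "w \<bullet> (A + ?Z) \<le> 2 * (w \<bullet> (A + ?Z))"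
        using w(1)[OF V1_scaleR[OF MV, of 2]] by simp
      ultimately have w0: "w \<bullet> (A + ?Z) = 0" by linarith
      have nonneg: "0 \<le> w \<bullet> C" if "C \<in> V1" for C using w(1)[OF that] w0 by simp
      have "rel_interior V1 \<noteq> {}" using rel_interior_eq_empty[OF conv] AV1 by auto
      \<comment> \<open>Strictness on the relative interior excludes a functional that vanishes on
        all of \<open>V1\<close>.\<close>
      then have pos: "\<exists>C\<in>V1. 0 < w \<bullet> C" using w(2) w0 rel_interior_subset by fastforce
      have "w \<bullet> A = 0" "w \<bullet> ?Z = 0"
        using nonneg[OF AV1] nonneg[OF rank_one_tensor_in_V1, of "x k" "y k"] w0
        unfolding inner_add_right by linarith+
      then have "?W \<bullet> ?Z = 0"
        using supporting_functional_kills_zeros_of_choi_witness[OF b s nonneg pos] AV1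
        unfolding A_def eb by blast
      then show ?thesis
        using face_of_V1_contains_zeros[OF b s F_face] AF unfolding A_def eb by blast
    qed
    moreover have "(\<Sum>k<m. rank_one (tensor_vec (x k) (y k))) \<in> F" if "m \<le> n" for m
      using that calculation
    proof (induction m)
      case 0
      then show ?case
        using face_of_cone_addD(2)[OF F_face cone AV1 convex_cone_contains_0[OF cone]] AF by simp
    next
      case (Suc m)
      then show ?case using face_of_cone_add[OF F_face cone] by simp
    qed
    ultimately show "B \<in> F" by (simp add: Bs)
  qed

  have "rel_interior F \<subseteq> rel_interior PPT"
  proof (rule subset_rel_interior_convex)
    show "convex F" using F_face by (rule face_of_imp_convex)
    show "convex PPT" using convex_cone_PPT by (simp add: convex_cone_def)
    show "F \<subseteq> closure PPT"
      using face_of_imp_subset[OF F_face] V1_subset_PPT closure_subset by blast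
    \<comment> \<open>The single point \<open>A\<close> in the relative interior of
      \<open>PPT\<close> suffices to carry the whole relative interior of \<open>F\<close>
      there.\<close>
    show "\<not> F \<subseteq> rel_frontier PPT" using AF PPT by (auto simp: rel_frontier_def)
  qed
  moreover have "F proper_face_of V1" using F_face F_proper by (simp add: proper_face_of_def)
  moreover from this have "F maximal_face_of V1"
    using max by (auto simp: maximal_face_of_def proper_face_of_def)
  ultimately show ?thesis
    using range PPT AV1 bdry unfolding boundary_of_convex_def A_def F_def by blast
qed

end
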